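(* If $c=c^*$, then there exists a monotone function $\phi\in C^2(\mathbb{R},\mathbb{R})$ satisfying $$\phi''(\xi)-c\,\phi'(\xi)-d\,\phi(\xi)+b\big(\phi(\xi-c\,\tau(\phi(\xi)))\big)=0,\qquad \xi\in\mathbb{R},$$ together with $$\lim_{\xi\to-\infty}\phi(\xi)=0,\qquad \lim_{\xi\to+\infty}\phi(\xi)=K.$$
   Context: Setting. $d>0$ is a constant. The birth function $b:[0,\infty)\to[0,\infty)$ satisfies, for some constant $K>0$: $b(0)=0$, $b(K)=dK$, $b(u)>du$ for $u\in(0,K)$, and $0<b(u)<du$ for $u>K$. The delay function $\tau:[0,\infty)\to[0,\infty)$ is $C^1$ on $[0,\infty)$, satisfies $0\le\tau'(u)<1$ for all $u\ge 0$, and $0\le m:=\tau(0)\le\lim_{u\to\infty}\tau(u)=:M<\infty$. Monotone birth function assumptions: $b$ is $C^1$ on $[0,K]$; $b'(0)>d$ and $b(u)<b'(0)u$ for $u\in(0,K]$; $0\le b'(u)\le b'(0)$ for $u\in[0,K]$; and there is $L>0$ such that $0\le b'(0)u-b(u)<Lu^2$ for $u\in(0,K]$. Definition of $c^*$. For $\lambda\ge0$, $c\ge0$ let $\Lambda(\lambda,c)=\lambda^2-c\lambda-d+b'(0)e^{-\lambda c m}$. Then $c^*>0$ is the constant such that $\Lambda(\lambda,c)>0$ for all $\lambda\ge0$ if $c\in[0,c^* )$, while for $c>c^*$ the equation $\Lambda(\lambda,c)=0$ has exactly two distinct positive real roots $\lambda_1(c)<\lambda_2(c)$, with $\Lambda(\cdot,c)<0$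 on $(\lambda_1(c),\lambda_2(c))$ and $\Lambda(\cdot,c)>0$ on $[0,\lambda_1(c))\cup(\lambda_2(c),\infty)$. *)

theory Defs
  imports "HOL-Analysis.Analysis"
begin

text \<open>
  The characteristic function of the wave equation linearised at \<open>0\<close>; the parameter \<open>p\<close> stands
  for \<open>b'(0)\<close>, and \<open>m\<close> for \<open>\<tau>(0)\<close>.
\<close>

definition char_fun :: "real \<Rightarrow> real \<Rightarrow> real \<Rightarrow> real \<Rightarrow> real \<Rightarrow> real" where
  "char_fun d p m l c = l\<^sup>2 - c * l - d + p * exp (- l * c * m)"

definition is_critical_speed :: "real \<Rightarrow> real \<Rightarrow> real \<Rightarrow> real \<Rightarrow> bool" where
  "is_critical_speed d p m cs \<longleftrightarrow>
     cs > 0 \<and>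
     (\<forall>c\<in>{0..<cs}. \<forall>l\<ge>0. char_fun d p m l c > 0) \<and>
     (\<forall>c>cs. \<exists>l1 l2. 0 < l1 \<and> l1 < l2 \<and>
        {l. l > 0 \<and> char_fun d p m l c = 0} = {l1, l2} \<and>
        (\<forall>l\<in>{l1<..<l2}. char_fun d p m l c < 0) \<and>
        (\<forall>l\<in>{0..<l1} \<union> {l2<..}. char_fun d p m l c > 0))"

definition critical_speed :: "real \<Rightarrow> real \<Rightarrow> real \<Rightarrow> real" where
  "critical_speed d p m = (THE cs. is_critical_speed d p m cs)"

lemma char_fun_strictly_convex:
  assumes "p > 0" "x < y" "y < z"
  shows "\<exists>t. 0 < t \<and> t < 1 \<and>
    char_fun d p m y c < (1 - t) * char_fun d p m x c + t * char_fun d p m z c"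
proof -
  define t where "t = (y - x) / (z - x)"
  have t: "0 < t" "t < 1" using assms by (auto simp: t_def)
  have "t * (z - x) = y - x" using assms by (simp add: t_def)
  then have y: "y = (1 - t) * x + t * z" by (simp add: algebra_simps)
  have "exp ((1 - t) *\<^sub>R (- x * c * m) + t *\<^sub>R (- z * c * m))
      \<le> (1 - t) * exp (- x * c * m) + t * exp (- z * c * m)"
    using t by (intro convex_onD[OF exp_convex]) auto
  moreover have "(1 - t) *\<^sub>R (- x * c * m) + t *\<^sub>R (- z * c * m) = - y * c * m"
    by (simp add: y algebra_simps)
  ultimately have e: "exp (- y * c * m) \<le> (1 - t) * exp (- x * c * m) + t * exp (- z * c * m)"
    by metis
  have e: "p * exp (- y * c * m) \<le> p * ((1 - t) * exp (- x * c * m) + t * exp (- z * c * m))"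
    using e assms by (intro mult_left_mono) auto
  have "0 < t * (1 - t) * (z - x)\<^sup>2" using t assms by simp
  also have "\<dots> = (1 - t) * x\<^sup>2 + t * z\<^sup>2 - y\<^sup>2"
    by (simp add: y power2_eq_square algebra_simps)
  finally have "y\<^sup>2 < (1 - t) * x\<^sup>2 + t * z\<^sup>2" by simp
  moreover have "- c * y - d = (1 - t) * (- c * x - d) + t * (- c * z - d)"
    by (simp add: y algebra_simps)
  ultimately have "char_fun d p m y c < (1 - t) * char_fun d p m x c + t * char_fun d p m z c"
    using e unfolding char_fun_def by (simp add: algebra_simps)
  then show ?thesis using t by blast
qed

lemma char_fun_roots:
  assumes p: "p > d" "d > 0" and c: "c \<ge> 0" and l0: "l0 > 0" "char_fun d p m l0 c < 0"
  shows "\<exists>l1 l2. 0 < l1 \<and> l1 < l2 \<and>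
        {l. l > 0 \<and> char_fun d p m l c = 0} = {l1, l2} \<and>
        (\<forall>l\<in>{l1<..<l2}. char_fun d p m l c < 0) \<and>
        (\<forall>l\<in>{0..<l1} \<union> {l2<..}. char_fun d p m l c > 0)"
proof -
  let ?f = "\<lambda>l. char_fun d p m l c"
  have cont: "continuous_on A ?f" for A
    unfolding char_fun_def by (intro continuous_intros)
  have f0: "?f 0 > 0" using p by (simp add: char_fun_def)
  define z where "z = l0 + c + d + 1"
  have "z * 1 \<le> z * (z - c)" using c l0 p by (intro mult_left_mono) (auto simp: z_def)
  moreover have "z * (z - c) = z\<^sup>2 - c * z" by (simp add: power2_eq_square algebra_simps)
  moreover have "z > d" using c l0 by (simp add: z_def)
  ultimately have "z\<^sup>2 - c * z - d > 0" by linarith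
  moreover have "p * exp (- z * c * m) > 0" using p by simp
  ultimately have fz: "?f z > 0" unfolding char_fun_def by linarith
  have zl: "l0 < z" using c p by (simp add: z_def)
  obtain l1 where l1: "0 \<le> l1" "l1 \<le> l0" "?f l1 = 0"
    using IVT2'[of ?f l0 0 0] cont f0 l0 by force
  obtain l2 where l2: "l0 \<le> l2" "l2 \<le> z" "?f l2 = 0"
    using IVT'[of ?f l0 0 z] cont fz l0 zl by force
  have "l1 \<noteq> 0" "l1 \<noteq> l0" using l1 f0 l0 by auto
  then have o: "0 < l1" "l1 < l2" using l1 l2 by auto
  have p0: "p > 0" using p by linarith
  have neg: "?f l < 0" if "l1 < l" "l < l2" for l
    using char_fun_strictly_convex[OF p0 that, of d m c] l1 l2 by auto
  have pos2: "?f l > 0" if "l2 < l" for l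
    using char_fun_strictly_convex[OF p0 o(2) that, of d m c] l1 l2
    by (auto simp: zero_less_mult_iff)
  have pos1: "?f l > 0" if "l < l1" for l
    using char_fun_strictly_convex[OF p0 that o(2), of d m c] l1 l2
    by (auto simp: zero_less_mult_iff)
  have "{l. l > 0 \<and> ?f l = 0} = {l1, l2}"
  proof (intro equalityI subsetI)
    fix l assume "l \<in> {l. l > 0 \<and> ?f l = 0}"
    then have "?f l = 0" by simp
    then have "\<not> (l1 < l \<and> l < l2)" "\<not> l2 < l" "\<not> l < l1"
      using neg[of l] pos1[of l] pos2[of l] by auto
    then show "l \<in> {l1, l2}" by auto
  qed (use l1 l2 o in auto)
  with neg pos1 pos2 o show ?thesis by (intro exI[of _ l1] exI[of _ l2]) auto
qed

lemma char_fun_strict_antimono: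
  assumes "p > 0" "m \<ge> 0" "l > 0" "c < c'"
  shows "char_fun d p m l c' < char_fun d p m l c"
proof -
  have "l * c * m \<le> l * c' * m"
    using assms by (intro mult_right_mono mult_left_mono) auto
  then have "p * exp (- l * c' * m) \<le> p * exp (- l * c * m)"
    using assms by simp
  moreover have "c * l < c' * l" using assms by simp
  ultimately show ?thesis unfolding char_fun_def by linarith
qed

lemma ex1_critical_speed:
  assumes p: "d > 0" "p > d" and m: "m \<ge> 0"
  shows "\<exists>!cs. is_critical_speed d p m cs"
proof -
  have p0: "p > 0" using p by linarith
  define S where "S = {c. c \<ge> 0 \<and> (\<exists>l\<ge>0. char_fun d p m l c \<le> 0)}"
  have "1 + p - d \<in> S"
  proof -
    have "0 \<le> (1 + p - d) * m" using p m by (intro mult_nonneg_nonneg) auto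
    then have "exp (- 1 * (1 + p - d) * m) \<le> 1" by (simp add: algebra_simps)
    then have "p * exp (- 1 * (1 + p - d) * m) \<le> p * 1"
      using p0 by (intro mult_left_mono) auto
    then have "char_fun d p m 1 (1 + p - d) \<le> 0"
      unfolding char_fun_def by simp
    then show ?thesis using p by (auto simp: S_def intro!: exI[of _ 1])
  qed
  then have ne: "S \<noteq> {}" by auto
  have bdd: "bdd_below S" by (auto simp: S_def intro: bdd_belowI[of _ 0])
  define q where "q = 1 + p * m"
  have q: "q > 0" using p0 m by (simp add: q_def add_pos_nonneg)
  define e where "e = sqrt (p - d) / q"
  have e: "e > 0" using p q by (simp add: e_def)
  have low: "e \<le> c" if "c \<in> S" for c
  proof (rule ccontr)
    assume "\<not> e \<le> c"
    then have ce: "c < e" by simp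
    from that obtain l where l: "c \<ge> 0" "l \<ge> 0" "char_fun d p m l c \<le> 0"
      by (auto simp: S_def)
    have "1 - l * c * m \<le> exp (- l * c * m)"
      using exp_ge_add_one_self[of "- l * c * m"] by simp
    then have "p * (1 - l * c * m) \<le> p * exp (- l * c * m)"
      using p0 by (intro mult_left_mono) auto
    then have "l\<^sup>2 - (c * q) * l + (p - d) \<le> 0"
      using l unfolding char_fun_def q_def by (simp add: algebra_simps)
    moreover have "0 \<le> (l - c * q / 2)\<^sup>2" by simp
    ultimately have "p - d \<le> (c * q)\<^sup>2 / 4"
      by (simp add: power2_eq_square algebra_simps)
    moreover have "c * q < sqrt (p - d)" using ce q by (simp add: e_def field_simps)
    then have "(c * q)\<^sup>2 < (sqrt (p - d))\<^sup>2"
      using l q by (intro power_strict_mono) auto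
    then have "(c * q)\<^sup>2 < p - d" using p by simp
    ultimately show False using p by linarith
  qed
  have "e \<le> Inf S" using low ne by (intro cInf_greatest)
  then have pos: "Inf S > 0" using e by linarith
  have A: "char_fun d p m l c > 0" if "0 \<le> c" "c < Inf S" "l \<ge> 0" for c l
  proof (rule ccontr)
    assume "\<not> ?thesis"
    then have "c \<in> S" using that by (auto simp: S_def not_less)
    then have "Inf S \<le> c" using bdd by (rule cInf_lower)
    then show False using that by simp
  qed
  have B: "\<exists>l0>0. char_fun d p m l0 c < 0" if c: "c > Inf S" for c
  proof -
    obtain c0 where c0: "c0 \<in> S" "c0 < c"
      using c ne bdd by (auto simp: cInf_less_iff)
    then obtain l where l: "l \<ge> 0" "char_fun d p m l c0 \<le> 0" by (auto simp: S_def)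
    have "l \<noteq> 0" using l p by (auto simp: char_fun_def)
    then have "l > 0" using l by simp
    then show ?thesis
      using char_fun_strict_antimono[OF p0 m _ c0(2), of l d] l by force
  qed
  have ex: "is_critical_speed d p m (Inf S)"
    unfolding is_critical_speed_def
  proof (intro conjI ballI allI impI)
    fix c assume c: "Inf S < c"
    then obtain l0 where "l0 > 0" "char_fun d p m l0 c < 0" using B by blast
    then show "\<exists>l1 l2. 0 < l1 \<and> l1 < l2 \<and>
        {l. l > 0 \<and> char_fun d p m l c = 0} = {l1, l2} \<and>
        (\<forall>l\<in>{l1<..<l2}. char_fun d p m l c < 0) \<and>
        (\<forall>l\<in>{0..<l1} \<union> {l2<..}. char_fun d p m l c > 0)"
      using c pos by (intro char_fun_roots[OF p(2,1)]) auto
  qed (use pos A in auto)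
  have no: False if cs: "is_critical_speed d p m c1" "is_critical_speed d p m c2" "c1 < c2" for c1 c2
  proof -
    define c where "c = (c1 + c2) / 2"
    have c: "c1 < c" "c < c2" using cs by (auto simp: c_def)
    obtain l1 l2 where "0 < l1" "{l. l > 0 \<and> char_fun d p m l c = 0} = {l1, l2}"
      using cs(1) c(1) unfolding is_critical_speed_def by meson
    then have l1: "0 \<le> l1" "char_fun d p m l1 c = 0" by auto
    have "c \<in> {0..<c2}" using cs(1) c unfolding is_critical_speed_def by simp
    then have "char_fun d p m l1 c > 0"
      using cs(2) l1(1) unfolding is_critical_speed_def by blast
    then show False using l1 by simp
  qed
  show ?thesis
  proof (rule ex1I[of _ "Inf S"], rule ex)
    fix c assume "is_critical_speed d p m c"
    then show "c = Inf S" using no[of c "Inf S"] no[of "Inf S" c] ex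
      by (cases c "Inf S" rule: linorder_cases) auto
  qed
qed

lemma is_critical_speed_critical_speed:
  assumes "d > 0" "p > d" "m \<ge> 0"
  shows "is_critical_speed d p m (critical_speed d p m)"
  unfolding critical_speed_def by (rule theI'[OF ex1_critical_speed[OF assms]])

end

theory Submission
  imports Defs "HOL-Complex_Analysis.Great_Picard"
begin

text \<open>
  Idea. For \<open>\<beta> = a (a + c) - d\<close> the wave equation reads \<open>\<phi> = T \<phi>\<close>, where \<open>T\<close> inverts
  \<open>- (D + a) (D - a - c)\<close> and is applied to \<open>\<beta> \<phi>(x) + b (\<phi>(x - c \<tau>(\<phi>(x))))\<close>. The image of \<open>T\<close>
  has Lipschitz constant at most \<open>a K\<close>, of the order of the square root of \<open>\<beta>\<close>, so that for
  large \<open>a\<close> the operator \<open>T\<close> is order preserving on the nondecreasing \<open>a K\<close>-Lipschitz profiles in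
  spite of the state-dependent delay. A positive root \<open>l\<close> of the characteristic function at the
  critical speed makes \<open>K exp (l x)\<close> a supersolution. Instead of a subsolution one uses small ramps
  \<open>w\<close> vanishing on the left: monotone iteration gives \<open>\<phi> = max w (T \<phi>)\<close> below
  \<open>K exp (l x)\<close>, and such a \<open>\<phi>\<close> connects \<open>0\<close> to \<open>K\<close>. Translate it so that \<open>\<phi> 0 = K / 2\<close> and let
  the height of the ramp tend to \<open>0\<close>; a limit point is a fixed point of \<open>T\<close>, and the normalisation
  at \<open>0\<close> forces its limits to be the two equilibria.
\<close>

subsection \<open>Exponential averages and the inverse of \<open>- (D + a) (D - e)\<close>\<close>

text \<open>For bounded continuous \<open>h\<close> this is the bounded solution of
  \<open>u' + a u = h\<close>. Since \<open>x\<close> enters only through the argument of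
  \<open>h\<close>, translations and pointwise limits pass straight into the integrand.\<close>

definition exp_avg :: "real \<Rightarrow> (real \<Rightarrow> real) \<Rightarrow> real \<Rightarrow> real" where
  "exp_avg a h x = (LINT s|lborel. indicator {0..} s * (exp (- a * s) * h (x - s)))"

lemma has_bochner_integral_exp_half_line:
  fixes a :: real
  assumes "a > 0"
  shows "has_bochner_integral lborel (\<lambda>s. indicator {0..} s * exp (- a * s)) (1 / a)"
proof (rule has_bochner_integral_nn_integral)
  have "((\<lambda>s. - exp (- a * s) / a) \<longlongrightarrow> - 0 / a) at_top"
    using assms
    by (intro tendsto_intros filterlim_compose[OF exp_at_bot]
        filterlim_tendsto_neg_mult_at_bot[OF tendsto_const]) (auto intro: filterlim_ident)
  then have "((\<lambda>s. - exp (- a * s) / a) \<longlongrightarrow> 0) at_top"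
    by simp
  then have "(\<integral>\<^sup>+s. ennreal (exp (- a * s)) * indicator {0..} s \<partial>lborel)
      = ennreal (0 - (- exp (- a * 0) / a))"
    using assms
    by (intro nn_integral_FTC_atLeast[where F = "\<lambda>s. - exp (- a * s) / a"])
      (auto intro!: derivative_eq_intros)
  also have "(\<integral>\<^sup>+s. ennreal (exp (- a * s)) * indicator {0..} s \<partial>lborel)
      = (\<integral>\<^sup>+s. ennreal (indicator {0..} s * exp (- a * s)) \<partial>lborel)"
    by (intro nn_integral_cong) (auto split: split_indicator)
  finally show "(\<integral>\<^sup>+s. ennreal (indicator {0..} s * exp (- a * s)) \<partial>lborel) = ennreal (1 / a)"
    by simp
qed (use assms in auto)

lemma integrable_exp_avg:
  fixes h :: "real \<Rightarrow> real"
  assumes "a > 0" "h \<in> borel_measurable borel" "bounded (range h)"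
  shows "integrable lborel (\<lambda>s. indicator {0..} s * (exp (- a * s) * h (x - s)))"
proof -
  obtain B where B: "\<And>x. \<bar>h x\<bar> \<le> B"
    using assms(3) by (auto simp: bounded_iff)
  have "integrable lborel (\<lambda>s. B * (indicator {0..} s * exp (- a * s)))"
    using has_bochner_integral_exp_half_line[OF assms(1)] has_bochner_integral_iff
    by (intro integrable_mult_right) blast
  then show ?thesis
  proof (rule Bochner_Integration.integrable_bound)
    show "(\<lambda>s. indicator {0..} s * (exp (- a * s) * h (x - s))) \<in> borel_measurable lborel"
      using assms(2) by measurable
    have "0 \<le> B" using B[of 0] by linarith
    then show "AE s in lborel. norm (indicator {0..} s * (exp (- a * s) * h (x - s)))
        \<le> norm (B * (indicator {0..} s * exp (- a * s)))"
      using B by (intro AE_I2) (auto simp: abs_mult mult.commute intro!: mult_left_mono split: split_indicator)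
  qed
qed

lemma exp_avg_mono:
  assumes "a > 0" "h \<in> borel_measurable borel" "bounded (range h)"
    "k \<in> borel_measurable borel" "bounded (range k)" "\<And>x. h x \<le> k x"
  shows "exp_avg a h x \<le> exp_avg a k x"
  unfolding exp_avg_def using assms
  by (intro integral_mono integrable_exp_avg) (auto split: split_indicator)

text \<open>The function \<open>exp (l * x)\<close> is an eigenfunction of the average with
  eigenvalue \<open>1 / (a + l)\<close>. The exponent may be negative, which is how the reflected
  average uses it.\<close>

lemma exp_avg_le_exp:
  assumes "a > 0" "h \<in> borel_measurable borel" "bounded (range h)"
    and "a + l > 0" "\<And>x. h x \<le> C * exp (l * x)"
  shows "exp_avg a h x \<le> C / (a + l) * exp (l * x)"
proof -
  have I: "has_bochner_integral lborel
      (\<lambda>s. (C * exp (l * x)) * (indicator {0..} s * exp (- (a + l) * s))) ((C * exp (l * x)) * (1 / (a + l)))"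
    using has_bochner_integral_exp_half_line[OF assms(4)]
    by (intro has_bochner_integral_mult_right)
  have "exp_avg a h x \<le> (LINT s|lborel. (C * exp (l * x)) * (indicator {0..} s * exp (- (a + l) * s)))"
    unfolding exp_avg_def
  proof (intro integral_mono integrable_exp_avg assms(1-3))
    show "integrable lborel (\<lambda>s. (C * exp (l * x)) * (indicator {0..} s * exp (- (a + l) * s)))"
      using I has_bochner_integral_iff by blast
    fix s
    have "exp (- a * s) * h (x - s) \<le> exp (- a * s) * (C * exp (l * (x - s)))"
      using assms(5) by (intro mult_left_mono) auto
    also have "\<dots> = C * exp (l * x) * exp (- (a + l) * s)"
      by (simp add: exp_add[symmetric] algebra_simps)
    finally show "indicator {0..} s * (exp (- a * s) * h (x - s))
        \<le> C * exp (l * x) * (indicator {0..} s * exp (- (a + l) * s))"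
      by (auto split: split_indicator)
  qed
  also have "\<dots> = C / (a + l) * exp (l * x)"
    using has_bochner_integral_integral_eq[OF I] by simp
  finally show ?thesis .
qed

lemma exp_avg_const:
  assumes "a > 0"
  shows "exp_avg a (\<lambda>x. C) x = C / a"
proof -
  have "exp_avg a (\<lambda>x. C) x = (LINT s|lborel. C * (indicator {0..} s * exp (- a * s)))"
    unfolding exp_avg_def by (simp add: algebra_simps)
  also have "\<dots> = C / a"
    using has_bochner_integral_integral_eq[OF has_bochner_integral_exp_half_line[OF assms]] by simp
  finally show ?thesis .
qed

lemma exp_avg_bounds:
  assumes "a > 0" "h \<in> borel_measurable borel" "\<And>x. 0 \<le> h x \<and> h x \<le> C"
  shows "0 \<le> exp_avg a h x \<and> exp_avg a h x \<le> C / a"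
proof -
  have "bounded (range h)"
    using assms(3) by (intro boundedI[of _ C]) auto
  then have "exp_avg a (\<lambda>x. 0) x \<le> exp_avg a h x" "exp_avg a h x \<le> exp_avg a (\<lambda>x. C) x"
    using assms by (auto intro!: exp_avg_mono)
  then show ?thesis
    using exp_avg_const[OF assms(1)] by simp
qed

lemma exp_avg_shift: "exp_avg a (\<lambda>x. h (x + t)) x = exp_avg a h (x + t)"
  by (simp add: exp_avg_def algebra_simps)

lemma tendsto_exp_avg:
  fixes h :: "nat \<Rightarrow> real \<Rightarrow> real"
  assumes "a > 0" "\<And>n. h n \<in> borel_measurable borel" "k \<in> borel_measurable borel"
    and "\<And>n x. \<bar>h n x\<bar> \<le> B" "\<And>x. (\<lambda>n. h n x) \<longlonglongrightarrow> k x"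
  shows "(\<lambda>n. exp_avg a (h n) x) \<longlonglongrightarrow> exp_avg a k x"
  unfolding exp_avg_def
proof (rule integral_dominated_convergence)
  show "integrable lborel (\<lambda>s. B * (indicator {0..} s * exp (- a * s)))"
    using has_bochner_integral_exp_half_line[OF assms(1)] has_bochner_integral_iff
    by (intro integrable_mult_right) blast
  show "AE s in lborel. norm (indicator {0..} s * (exp (- a * s) * h n (x - s)))
        \<le> B * (indicator {0..} s * exp (- a * s))" for n
    using assms(4)
    by (intro AE_I2) (auto simp: abs_mult mult.commute intro!: mult_left_mono split: split_indicator)
  show "AE s in lborel. (\<lambda>n. indicator {0..} s * (exp (- a * s) * h n (x - s)))
      \<longlonglongrightarrow> indicator {0..} s * (exp (- a * s) * k (x - s))"
    by (intro AE_I2 tendsto_intros assms(5))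
  show "(\<lambda>s. indicator {0..} s * (exp (- a * s) * k (x - s))) \<in> borel_measurable lborel"
    using assms(3) by measurable
  show "(\<lambda>s. indicator {0..} s * (exp (- a * s) * h n (x - s))) \<in> borel_measurable lborel" for n
    using assms(2)[of n] by measurable
qed

text \<open>The substitution \<open>t = x - s\<close> moves \<open>x\<close> out of \<open>h\<close>
  into the endpoint and a prefactor, the form suited to differentiation.\<close>

lemma exp_avg_eq_convolution:
  "exp_avg a h x = exp (- a * x) * (LINT t|lborel. indicator {..x} t * (exp (a * t) * h t))"
proof -
  have "exp_avg a h x
      = (LINT t|lborel. indicator {0..} (x - t) * (exp (- a * (x - t)) * h (x - (x - t))))"
    unfolding exp_avg_def by (subst lborel_integral_real_affine[where c = "-1" and t = x]) simp_all
  also have "\<dots> = (LINT t|lborel. exp (- a * x) * (indicator {..x} t * (exp (a * t) * h t)))"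
  proof (rule Bochner_Integration.integral_cong[OF refl])
    fix t :: real
    have "exp (- a * (x - t)) = exp (- a * x) * exp (a * t)"
      by (simp add: exp_add[symmetric] algebra_simps)
    then show "indicator {0..} (x - t) * (exp (- a * (x - t)) * h (x - (x - t)))
        = exp (- a * x) * (indicator {..x} t * (exp (a * t) * h t))"
      by (auto split: split_indicator)
  qed
  finally show ?thesis
    by simp
qed

text \<open>Product rule for \<open>exp (- a * x)\<close> times an integral with upper endpoint
  \<open>x\<close>; this is the equation \<open>u' = h - a u\<close>.\<close>

lemma exp_avg_has_derivative:
  assumes "a > 0" "continuous_on UNIV h" "bounded (range h)"
  shows "(exp_avg a h has_real_derivative h x - a * exp_avg a h x) (at x)"
proof -
  define g where "g t = exp (a * t) * h t" for t
  define F where "F y = (LINT t|lborel. indicator {..y} t * g t)" for y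
  have cg: "continuous_on A g" for A
    unfolding g_def using assms(2) continuous_on_subset by (intro continuous_intros) blast
  have h: "h \<in> borel_measurable borel"
    using assms(2) by (rule borel_measurable_continuous_onI)
  have int: "integrable lborel (\<lambda>t. indicator {..y} t * g t)" for y
  proof -
    have "integrable lborel (\<lambda>s. indicator {0..} s * (exp (- a * s) * h (y - s)))"
      using assms(1) h assms(3) by (rule integrable_exp_avg)
    then have "integrable lborel (\<lambda>t. indicator {0..} (y + - 1 * t) *
        (exp (- a * (y + - 1 * t)) * h (y - (y + - 1 * t))))"
      by (rule lborel_integrable_real_affine) simp
    then have "integrable lborel (\<lambda>t. exp (a * y) * (indicator {0..} (y + - 1 * t) *
        (exp (- a * (y + - 1 * t)) * h (y - (y + - 1 * t)))))"
      by (rule integrable_mult_right)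
    moreover have "exp (a * y) * (indicator {0..} (y + - 1 * t) *
        (exp (- a * (y + - 1 * t)) * h (y - (y + - 1 * t)))) = indicator {..y} t * g t" for t
      by (auto simp: g_def exp_add[symmetric] algebra_simps exp_minus split: split_indicator)
    ultimately show ?thesis
      by (simp only:)
  qed
  \<comment> \<open>Cutting the half-line at \<open>x - 1\<close> leaves a compact interval with
    variable endpoint, to which the fundamental theorem of calculus applies.\<close>
  have F: "F y = F (x - 1) + integral {x - 1..y} g" if "y \<in> {x - 1..x + 1}" for y
  proof -
    have ic: "integrable lborel (\<lambda>t. indicator {x - 1..y} t * g t)"
      using borel_integrable_atLeastAtMost'[OF cg] by (simp add: set_integrable_def)
    have "F y = (LINT t|lborel. indicator {..x - 1} t * g t + indicator {x - 1..y} t * g t)"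
      unfolding F_def
    proof (rule integral_cong_AE)
      \<comment> \<open>Both pieces contain \<open>x - 1\<close>, so the indicators add up only off
        this null set.\<close>
      show "AE t in lborel. indicator {..y} t * g t
          = indicator {..x - 1} t * g t + indicator {x - 1..y} t * g t"
        using AE_lborel_singleton[of "x - 1"]
        by eventually_elim (use that in \<open>auto split: split_indicator\<close>)
    qed (use int ic in \<open>auto intro!: borel_measurable_integrable\<close>)
    also have "\<dots> = F (x - 1) + (LINT t|lborel. indicator {x - 1..y} t * g t)"
      unfolding F_def using int ic by (rule Bochner_Integration.integral_add)
    also have "(LINT t|lborel. indicator {x - 1..y} t * g t) = integral {x - 1..y} g"
      using set_borel_integral_eq_integral(2)[OF borel_integrable_atLeastAtMost'[OF cg]]
      by (simp add: set_lebesgue_integral_def)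
    finally show ?thesis .
  qed
  have "((\<lambda>y. integral {x - 1..y} g) has_real_derivative g x) (at x within {x - 1..x + 1})"
    by (rule integral_has_real_derivative) (auto intro: cg)
  then have "((\<lambda>y. integral {x - 1..y} g) has_real_derivative g x) (at x)"
    by (simp add: at_within_Icc_at)
  then have "((\<lambda>y. F (x - 1) + integral {x - 1..y} g) has_real_derivative g x) (at x)"
    by (auto intro!: derivative_eq_intros)
  then have dF: "(F has_real_derivative g x) (at x)"
    by (rule has_field_derivative_transform_within_open[where S = "{x - 1<..<x + 1}"])
      (auto intro!: F[symmetric])
  have "exp_avg a h = (\<lambda>y. exp (- a * y) * F y)"
    by (simp add: fun_eq_iff exp_avg_eq_convolution F_def g_def)
  moreover have "((\<lambda>y. exp (- a * y) * F y) has_real_derivative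
      exp (- a * x) * g x - a * (exp (- a * x) * F x)) (at x)"
    by (rule derivative_eq_intros dF refl | simp)+
  ultimately show ?thesis
    by (simp add: g_def exp_minus mult.assoc[symmetric])
qed

text \<open>Reflection turns the inner average into an integral over the values of \<open>h\<close>
  to the right of \<open>x\<close>, which solves \<open>e q - q' = h\<close>. The outer average then
  solves \<open>u' + a u = q\<close>, so the composition inverts \<open>- (D + a) (D - e)\<close> on
  bounded continuous functions.\<close>

definition green_op :: "real \<Rightarrow> real \<Rightarrow> (real \<Rightarrow> real) \<Rightarrow> real \<Rightarrow> real" where
  "green_op a e h = exp_avg a (\<lambda>x. exp_avg e (\<lambda>y. h (- y)) (- x))"

lemma bounded_range_real: "bounded (range f) \<longleftrightarrow> (\<exists>B. \<forall>x. \<bar>f x :: real\<bar> \<le> B)"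
  by (auto simp: bounded_iff)

lemma exp_avg_reflect_has_derivative:
  assumes "e > 0" "continuous_on UNIV h" "bounded (range h)"
  shows "((\<lambda>x. exp_avg e (\<lambda>y. h (- y)) (- x)) has_real_derivative
    e * exp_avg e (\<lambda>y. h (- y)) (- x) - h x) (at x)"
proof -
  have "continuous_on UNIV (\<lambda>y. h (- y))"
    by (intro continuous_on_compose2[OF assms(2)] continuous_intros) auto
  moreover have "bounded (range (\<lambda>y. h (- y)))"
    using assms(3) by (auto simp: bounded_range_real)
  ultimately have "(exp_avg e (\<lambda>y. h (- y)) has_real_derivative
      h (- (- x)) - e * exp_avg e (\<lambda>y. h (- y)) (- x)) (at (- x))"
    using exp_avg_has_derivative[OF assms(1), of "\<lambda>y. h (- y)" "- x"] by simp
  moreover have "((\<lambda>x::real. - x) has_real_derivative - 1) (at x)"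
    by (auto intro!: derivative_eq_intros)
  ultimately have "((\<lambda>x. exp_avg e (\<lambda>y. h (- y)) (- x)) has_real_derivative
      (h (- (- x)) - e * exp_avg e (\<lambda>y. h (- y)) (- x)) * - 1) (at x)"
    by (rule DERIV_chain2)
  then show ?thesis
    by simp
qed

lemma has_real_derivative_imp_borel:
  assumes "\<And>x. (f has_real_derivative f' x) (at x)"
  shows "continuous_on UNIV f" "f \<in> borel_measurable borel"
proof -
  show "continuous_on UNIV f"
    using assms by (intro DERIV_continuous_on) (auto simp: has_field_derivative_at_within)
  then show "f \<in> borel_measurable borel"
    by (rule borel_measurable_continuous_onI)
qed

section \<open>Order, growth, limits and differential equation for the Green operator\<close>

context
  fixes a e :: real
  assumes a: "a > 0" and e: "e > 0"
begin

lemma exp_avg_reflect_bounds: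
  assumes "continuous_on UNIV h" "\<And>x. 0 \<le> h x \<and> h x \<le> C"
  shows "0 \<le> exp_avg e (\<lambda>y. h (- y)) x \<and> exp_avg e (\<lambda>y. h (- y)) x \<le> C / e"
proof (rule exp_avg_bounds[OF e])
  show "(\<lambda>y. h (- y)) \<in> borel_measurable borel"
    using borel_measurable_continuous_onI[OF assms(1)] by measurable
qed (use assms(2) in simp)

text \<open>Collects the side conditions under which the lemmas on \<open>exp_avg\<close> apply to
  the inner and the outer average.\<close>

lemma exp_avg_reflect_regular:
  assumes "continuous_on UNIV h" "\<And>x. 0 \<le> h x \<and> h x \<le> C"
  defines "q \<equiv> \<lambda>x. exp_avg e (\<lambda>y. h (- y)) (- x)"
  shows "continuous_on UNIV q" "q \<in> borel_measurable borel" "bounded (range q)"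
    "bounded (range h)" "bounded (range (\<lambda>x. h (- x)))"
    "(\<lambda>y. h (- y)) \<in> borel_measurable borel"
proof -
  show b: "bounded (range h)" "bounded (range (\<lambda>x. h (- x)))"
    using assms(2) by (auto intro!: boundedI[of _ C])
  show "continuous_on UNIV q" "q \<in> borel_measurable borel"
    unfolding q_def
    by (fact has_real_derivative_imp_borel[OF exp_avg_reflect_has_derivative[OF e assms(1) b(1)]])+
  show "bounded (range q)"
    unfolding q_def using exp_avg_reflect_bounds[OF assms(1,2)]
    by (auto intro!: boundedI[of _ "C / e"])
  show "(\<lambda>y. h (- y)) \<in> borel_measurable borel"
    using borel_measurable_continuous_onI[OF assms(1)] by measurable
qed

lemma green_op_mono:
  assumes "continuous_on UNIV h" "\<And>x. 0 \<le> h x \<and> h x \<le> C"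
    "continuous_on UNIV k" "\<And>x. 0 \<le> k x \<and> k x \<le> C" "\<And>x. h x \<le> k x"
  shows "green_op a e h x \<le> green_op a e k x"
proof -
  note rh = exp_avg_reflect_regular[OF assms(1,2)]
  note rk = exp_avg_reflect_regular[OF assms(3,4)]
  have "exp_avg e (\<lambda>y. h (- y)) (- x) \<le> exp_avg e (\<lambda>y. k (- y)) (- x)" for x
    by (rule exp_avg_mono[OF e rh(6,5) rk(6,5) assms(5)])
  then show ?thesis
    unfolding green_op_def by (rule exp_avg_mono[OF a rh(2,3) rk(2,3)])
qed

lemma green_op_bounds:
  assumes "continuous_on UNIV h" "\<And>x. 0 \<le> h x \<and> h x \<le> C"
  shows "0 \<le> green_op a e h x \<and> green_op a e h x \<le> C / (a * e)"
proof -
  have "0 \<le> green_op a e h x \<and> green_op a e h x \<le> C / e / a"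
    unfolding green_op_def
    using exp_avg_reflect_bounds[OF assms]
    by (rule exp_avg_bounds[OF a exp_avg_reflect_regular(2)[OF assms]])
  then show ?thesis
    by (simp add: mult.commute)
qed

text \<open>The eigenvalue of \<open>exp (l * x)\<close> is a product of two: reflection replaces
  \<open>l\<close> by \<open>- l\<close> in the inner average, whence the factor
  \<open>e - l\<close> and the condition that it be positive.\<close>

lemma green_op_le_exp:
  assumes "continuous_on UNIV h" "\<And>x. 0 \<le> h x \<and> h x \<le> C"
    and "a + l > 0" "e - l > 0" "\<And>x. h x \<le> B * exp (l * x)"
  shows "green_op a e h x \<le> B / ((a + l) * (e - l)) * exp (l * x)"
proof -
  have "exp_avg e (\<lambda>y. h (- y)) (- x) \<le> B / (e - l) * exp (l * x)" for x
    using exp_avg_le_exp[OF e exp_avg_reflect_regular(6,5)[OF assms(1,2)], of "- l" B "- x"]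
      assms(4) assms(5)[of "- y" for y]
    by simp
  then have "green_op a e h x \<le> B / (e - l) / (a + l) * exp (l * x)"
    unfolding green_op_def
    by (rule exp_avg_le_exp[OF a exp_avg_reflect_regular(2,3)[OF assms(1,2)] assms(3)])
  then show ?thesis
    by (simp add: mult.commute)
qed

lemma green_op_const: "green_op a e (\<lambda>x. C) x = C / (a * e)"
  using exp_avg_const[OF e, of C] exp_avg_const[OF a, of "C / e"]
  by (simp add: green_op_def mult.commute)

lemma green_op_shift: "green_op a e (\<lambda>x. h (x + t)) x = green_op a e h (x + t)"
proof -
  have "exp_avg e (\<lambda>y. h (- y + t)) (- x) = exp_avg e (\<lambda>y. h (- y)) (- (x + t))" for x
    using exp_avg_shift[of e "\<lambda>y. h (- y)" "- t" "- x"] by (simp add: algebra_simps)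
  then show ?thesis
    using exp_avg_shift[of a "\<lambda>x. exp_avg e (\<lambda>y. h (- y)) (- x)" t x]
    by (simp add: green_op_def)
qed

lemma tendsto_green_op:
  fixes h :: "nat \<Rightarrow> real \<Rightarrow> real"
  assumes "\<And>n. continuous_on UNIV (h n)" "\<And>n x. 0 \<le> h n x \<and> h n x \<le> C"
    "continuous_on UNIV k" "\<And>x. (\<lambda>n. h n x) \<longlonglongrightarrow> k x"
  shows "(\<lambda>n. green_op a e (h n) x) \<longlonglongrightarrow> green_op a e k x"
proof -
  have k: "0 \<le> k x \<and> k x \<le> C" for x
    using assms(2) by (auto intro!: LIMSEQ_le_const[OF assms(4)] LIMSEQ_le_const2[OF assms(4)])
  note rh = exp_avg_reflect_regular[OF assms(1,2)]
  note rk = exp_avg_reflect_regular[OF assms(3) k]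
  have "(\<lambda>n. exp_avg e (\<lambda>y. h n (- y)) (- x)) \<longlonglongrightarrow> exp_avg e (\<lambda>y. k (- y)) (- x)" for x
    using assms(2,4) by (intro tendsto_exp_avg[where B = C, OF e rh(6) rk(6)]) auto
  moreover have "\<bar>exp_avg e (\<lambda>y. h n (- y)) (- x)\<bar> \<le> C / e" for n x
    using exp_avg_reflect_bounds[OF assms(1,2), of n "- x"] by auto
  ultimately show ?thesis
    unfolding green_op_def by (rule tendsto_exp_avg[OF a rh(2) rk(2), rotated])
qed

text \<open>Differentiating \<open>u' = q - a u\<close> with \<open>q' = e q - h\<close> and
  eliminating \<open>q\<close> gives the second-order equation. The derivative bound holds because
  \<open>q\<close> and \<open>a * u\<close> both lie between \<open>0\<close> and
  \<open>C / e\<close>.\<close>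

lemma green_op_solves:
  assumes "continuous_on UNIV h" "\<And>x. 0 \<le> h x \<and> h x \<le> C"
  defines "u \<equiv> green_op a e h" and "q \<equiv> \<lambda>x. exp_avg e (\<lambda>y. h (- y)) (- x)"
  defines "u' \<equiv> \<lambda>x. q x - a * u x"
  defines "u'' \<equiv> \<lambda>x. (e - a) * u' x + a * e * u x - h x"
  shows "(u has_real_derivative u' x) (at x)"
    and "(u' has_real_derivative u'' x) (at x)"
    and "continuous_on UNIV u''"
    and "\<bar>u' x\<bar> \<le> C / e"
proof -
  note r = exp_avg_reflect_regular[OF assms(1,2)]
  have dq: "(q has_real_derivative e * q x - h x) (at x)" for x
    unfolding q_def by (rule exp_avg_reflect_has_derivative[OF e assms(1) r(4)])
  show du: "(u has_real_derivative u' x) (at x)" for x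
    using exp_avg_has_derivative[OF a r(1) r(3)]
    by (simp add: u_def u'_def q_def green_op_def)
  show du': "(u' has_real_derivative u'' x) (at x)" for x
  proof -
    have "(u' has_real_derivative e * q x - h x - a * u' x) (at x)"
      unfolding u'_def using dq[of x] du[of x]
      by (auto intro!: derivative_eq_intros simp: u'_def)
    then show ?thesis
      by (simp add: u''_def u'_def algebra_simps)
  qed
  show "continuous_on UNIV u''"
    unfolding u''_def
    using has_real_derivative_imp_borel(1)[OF du] has_real_derivative_imp_borel(1)[OF du'] assms(1)
    by (intro continuous_intros)
  have "0 \<le> q x \<and> q x \<le> C / e"
    unfolding q_def by (rule exp_avg_reflect_bounds[OF assms(1,2)])
  moreover have "0 \<le> a * u x \<and> a * u x \<le> C / e"
    using green_op_bounds[OF assms(1,2), of x] a e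
    by (simp add: u_def field_simps)
  ultimately show "\<bar>u' x\<bar> \<le> C / e"
    unfolding u'_def by (auto simp: abs_le_iff)
qed

end

subsection \<open>Order-preserving fixed point operator\<close>

text \<open>Derivatives of \<open>b\<close> and \<open>\<tau>\<close> are replaced by the
  monotonicity and Lipschitz estimates they imply; \<open>p\<close> plays the part of the slope of
  \<open>b\<close> at \<open>0\<close>. The condition \<open>char_le_0\<close> says that
  \<open>exp (l * x)\<close> is a supersolution of the linearised equation.\<close>

locale wave =
  fixes d p K c m l :: real and b \<tau> :: "real \<Rightarrow> real"
  assumes d_pos: "0 < d" and K_pos: "0 < K" and c_pos: "0 < c" and p_pos: "0 < p" and l_pos: "0 < l"
    and b_mono: "\<And>u v. 0 \<le> u \<Longrightarrow> u \<le> v \<Longrightarrow> v \<le> K \<Longrightarrow> b u \<le> b v"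
    and b_Lipschitz: "\<And>u v. 0 \<le> u \<Longrightarrow> u \<le> v \<Longrightarrow> v \<le> K \<Longrightarrow> b v - b u \<le> p * (v - u)"
    and b_0: "b 0 = 0" and b_K: "b K = d * K"
    and b_below_K: "\<And>u. 0 < u \<Longrightarrow> u < K \<Longrightarrow> b u > d * u"
    and \<tau>_0: "\<tau> 0 = m"
    and \<tau>_mono: "\<And>u v. 0 \<le> u \<Longrightarrow> u \<le> v \<Longrightarrow> \<tau> u \<le> \<tau> v"
    and \<tau>_Lipschitz: "\<And>u v. 0 \<le> u \<Longrightarrow> u \<le> v \<Longrightarrow> \<tau> v - \<tau> u \<le> v - u"
    and char_le_0: "char_fun d p m l c \<le> 0"
begin

text \<open>The difference \<open>e - a = c\<close> produces the first-order term of the wave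
  equation, and \<open>a * e = \<beta> + d\<close> its zero-order term after
  \<open>\<beta> * \<phi>\<close> is added to both sides. The summand \<open>p * c * K\<close> lets
  \<open>\<beta>\<close> dominate the effect of the delay.\<close>

definition "a = p * c * K + d + 1"
definition "e = a + c"
definition "\<beta> = a * e - d"

lemma a_pos: "0 < a"
  using p_pos c_pos K_pos d_pos by (simp add: a_def add_nonneg_pos)

lemma e_pos: "0 < e"
  using a_pos c_pos by (simp add: e_def)

text \<open>Expanding, \<open>a * e = p * c * K * a + a * (d + 1 + c)\<close>, and the second
  summand is at least \<open>d\<close> because \<open>a \<ge> 1\<close>.\<close>

lemma \<beta>_ge: "p * c * (a * K) \<le> \<beta>"
proof -
  have "a \<ge> 1"
    using p_pos c_pos K_pos d_pos by (simp add: a_def)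
  then have "1 * d \<le> a * (d + 1 + c)"
    using d_pos c_pos by (intro mult_mono) auto
  then show ?thesis
    by (simp add: \<beta>_def e_def a_def[symmetric] algebra_simps) (simp add: a_def algebra_simps)
qed

lemma \<beta>_nonneg: "0 \<le> \<beta>"
proof -
  have "0 \<le> p * c * (a * K)"
    using p_pos c_pos a_pos K_pos by simp
  then show ?thesis
    using \<beta>_ge by linarith
qed

lemma b_nonneg: "0 \<le> u \<Longrightarrow> u \<le> K \<Longrightarrow> 0 \<le> b u"
  using b_mono[of 0 u] b_0 by simp

lemma b_le_linear: "0 \<le> u \<Longrightarrow> u \<le> K \<Longrightarrow> b u \<le> p * u"
  using b_Lipschitz[of 0 u] b_0 by simp

lemma tendsto_b:
  assumes "(f \<longlongrightarrow> u) F" "\<And>x. 0 \<le> f x \<and> f x \<le> K" "0 \<le> u" "u \<le> K"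
  shows "((\<lambda>x. b (f x)) \<longlongrightarrow> b u) F"
proof (rule metric_tendsto_imp_tendsto)
  show "((\<lambda>x. p * f x) \<longlongrightarrow> p * u) F"
    by (intro tendsto_intros assms(1))
  have "\<bar>b v - b u\<bar> \<le> \<bar>p * v - p * u\<bar>" if "0 \<le> v" "v \<le> K" for v
    using b_mono[of u v] b_mono[of v u] b_Lipschitz[of u v] b_Lipschitz[of v u] that assms(3,4)
    by (cases "u \<le> v") (auto simp: algebra_simps)
  then show "\<forall>\<^sub>F x in F. dist (b (f x)) (b u) \<le> dist (p * f x) (p * u)"
    using assms(2) by (simp add: dist_real_def)
qed

lemma tendsto_\<tau>:
  assumes "(f \<longlongrightarrow> u) F" "\<And>x. 0 \<le> f x" "0 \<le> u"
  shows "((\<lambda>x. \<tau> (f x)) \<longlongrightarrow> \<tau> u) F"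
proof (rule metric_tendsto_imp_tendsto[OF assms(1)])
  have "\<bar>\<tau> v - \<tau> u\<bar> \<le> \<bar>v - u\<bar>" if "0 \<le> v" for v
    using \<tau>_mono[of u v] \<tau>_mono[of v u] \<tau>_Lipschitz[of u v] \<tau>_Lipschitz[of v u] that assms(3)
    by (cases "u \<le> v") auto
  then show "\<forall>\<^sub>F x in F. dist (\<tau> (f x)) (\<tau> u) \<le> dist (f x) u"
    using assms(2) by (simp add: dist_real_def)
qed

text \<open>The Lipschitz constant \<open>a * K\<close> is the derivative bound that
  \<open>T\<close> produces, so that \<open>T\<close> preserves the set. Being common to all
  profiles, it also gives compactness.\<close>

definition profiles :: "(real \<Rightarrow> real) set" where
  "profiles = {\<phi>. mono \<phi> \<and> (\<forall>x. 0 \<le> \<phi> x \<and> \<phi> x \<le> K) \<and> (\<forall>x y. \<bar>\<phi> x - \<phi> y\<bar> \<le> a * K * \<bar>x - y\<bar>)}"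

definition reaction :: "(real \<Rightarrow> real) \<Rightarrow> real \<Rightarrow> real" where
  "reaction \<phi> x = \<beta> * \<phi> x + b (\<phi> (x - c * \<tau> (\<phi> x)))"

definition T :: "(real \<Rightarrow> real) \<Rightarrow> real \<Rightarrow> real" where
  "T \<phi> = green_op a e (reaction \<phi>)"

section \<open>Convergence and closure properties of profiles\<close>

lemma profilesD:
  assumes "\<phi> \<in> profiles"
  shows "mono \<phi>" "0 \<le> \<phi> x" "\<phi> x \<le> K" "\<bar>\<phi> x - \<phi> y\<bar> \<le> a * K * \<bar>x - y\<bar>"
  using assms by (auto simp: profiles_def)

text \<open>The common Lipschitz constant lets the evaluation point move along with the function, as
  it does under a state-dependent delay. The filter is arbitrary because both sequences and limits
  at a point occur.\<close>

lemma tendsto_profiles: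
  assumes "\<And>i. f i \<in> profiles" "\<phi> \<in> profiles" "\<And>x. ((\<lambda>i. f i x) \<longlongrightarrow> \<phi> x) F" "(g \<longlongrightarrow> y) F"
  shows "((\<lambda>i. f i (g i)) \<longlongrightarrow> \<phi> y) F"
proof -
  have "((\<lambda>i. a * K * \<bar>g i - y\<bar>) \<longlongrightarrow> a * K * \<bar>y - y\<bar>) F"
    by (intro tendsto_intros assms(4))
  then have "((\<lambda>i. a * K * \<bar>g i - y\<bar>) \<longlongrightarrow> 0) F"
    by simp
  moreover have "\<forall>\<^sub>F i in F. norm (f i (g i) - f i y) \<le> a * K * \<bar>g i - y\<bar>"
    using profilesD(4)[OF assms(1)] by simp
  ultimately have "((\<lambda>i. f i (g i) - f i y) \<longlongrightarrow> 0) F"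
    by (rule Lim_null_comparison[rotated])
  then have "((\<lambda>i. (f i (g i) - f i y) + f i y) \<longlongrightarrow> 0 + \<phi> y) F"
    by (intro tendsto_add assms(3))
  then show ?thesis by simp
qed

lemma tendsto_reaction:
  assumes "\<And>i. f i \<in> profiles" "\<phi> \<in> profiles" "\<And>x. ((\<lambda>i. f i x) \<longlongrightarrow> \<phi> x) F"
  shows "((\<lambda>i. reaction (f i) x) \<longlongrightarrow> reaction \<phi> x) F"
  unfolding reaction_def using profilesD[OF assms(1)] profilesD[OF assms(2)]
  by (intro tendsto_intros tendsto_b tendsto_\<tau> tendsto_profiles[OF assms] assms(3)) auto

lemma profiles_shift:
  assumes "\<phi> \<in> profiles"
  shows "(\<lambda>x. \<phi> (x + t)) \<in> profiles"
  unfolding profiles_def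
proof (intro CollectI conjI allI)
  show "mono (\<lambda>x. \<phi> (x + t))"
    using profilesD(1)[OF assms] by (auto simp: mono_def)
  show "\<bar>\<phi> (x + t) - \<phi> (y + t)\<bar> \<le> a * K * \<bar>x - y\<bar>" for x y
    using profilesD(4)[OF assms, of "x + t" "y + t"] by simp
qed (use profilesD[OF assms] in auto)

lemma profiles_max:
  assumes "\<phi> \<in> profiles" "\<psi> \<in> profiles"
  shows "(\<lambda>x. max (\<phi> x) (\<psi> x)) \<in> profiles"
  unfolding profiles_def
proof (intro CollectI conjI allI)
  show "mono (\<lambda>x. max (\<phi> x) (\<psi> x))"
    using profilesD(1)[OF assms(1)] profilesD(1)[OF assms(2)]
    by (intro monoI max.mono) (auto dest: monoD)
  fix x y
  show "\<bar>max (\<phi> x) (\<psi> x) - max (\<phi> y) (\<psi> y)\<bar> \<le> a * K * \<bar>x - y\<bar>"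
    using profilesD(4)[OF assms(1), of x y] profilesD(4)[OF assms(2), of x y] by linarith
qed (use profilesD[OF assms(1)] profilesD[OF assms(2)] in \<open>auto simp: le_max_iff_disj\<close>)

lemma profiles_limit:
  fixes f :: "nat \<Rightarrow> real \<Rightarrow> real"
  assumes "\<And>n. f n \<in> profiles" "\<And>x. (\<lambda>n. f n x) \<longlonglongrightarrow> \<phi> x"
  shows "\<phi> \<in> profiles"
  unfolding profiles_def
proof (intro CollectI conjI allI)
  show "mono \<phi>"
    using profilesD(1)[OF assms(1)]
    by (auto intro!: monoI LIMSEQ_le[OF assms(2) assms(2)] simp: mono_def)
  show "0 \<le> \<phi> x" "\<phi> x \<le> K" for x
    using profilesD(2,3)[OF assms(1)]
    by (auto intro!: LIMSEQ_le_const[OF assms(2)] LIMSEQ_le_const2[OF assms(2)])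
  show "\<bar>\<phi> x - \<phi> y\<bar> \<le> a * K * \<bar>x - y\<bar>" for x y
  proof (rule LIMSEQ_le_const2)
    show "(\<lambda>n. \<bar>f n x - f n y\<bar>) \<longlonglongrightarrow> \<bar>\<phi> x - \<phi> y\<bar>"
      by (intro tendsto_intros assms(2))
  qed (use profilesD(4)[OF assms(1)] in auto)
qed

lemma continuous_on_profile:
  assumes "\<phi> \<in> profiles"
  shows "continuous_on A \<phi>"
  using tendsto_profiles[of "\<lambda>_. \<phi>" \<phi>, OF assms assms tendsto_const tendsto_ident_at]
  by (simp add: continuous_on_def)

lemma reaction_shift: "reaction (\<lambda>x. \<phi> (x + t)) x = reaction \<phi> (x + t)"
  by (simp add: reaction_def algebra_simps)

text \<open>Moving the point is the same as translating the profile, so continuity is an instance of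
  \<open>tendsto_reaction\<close> for the family of translates, evaluated at
  \<open>0\<close>.\<close>

lemma continuous_on_reaction:
  assumes "\<phi> \<in> profiles"
  shows "continuous_on A (reaction \<phi>)"
proof -
  have "(reaction \<phi> \<longlongrightarrow> reaction \<phi> x) (at x within A)" for x
  proof -
    have "((\<lambda>t. reaction (\<lambda>y. \<phi> (y + t)) 0) \<longlongrightarrow> reaction (\<lambda>y. \<phi> (y + x)) 0) (at x within A)"
    proof (rule tendsto_reaction)
      show "((\<lambda>t. \<phi> (y + t)) \<longlongrightarrow> \<phi> (y + x)) (at x within A)" for y
        by (rule tendsto_profiles[of "\<lambda>_. \<phi>" \<phi>, OF assms assms tendsto_const])
          (intro tendsto_intros)
    qed (intro profiles_shift assms)+
    then show ?thesis by (simp add: reaction_shift)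
  qed
  then show ?thesis by (simp add: continuous_on_def)
qed

text \<open>The upper bound is the value at the equilibrium \<open>K\<close>, where
  \<open>\<beta> * K + b K = a * e * K\<close>; after division by \<open>a * e\<close> it keeps
  \<open>T \<phi>\<close> below \<open>K\<close>.\<close>

lemma reaction_bounds:
  assumes "\<phi> \<in> profiles"
  shows "0 \<le> reaction \<phi> x \<and> reaction \<phi> x \<le> a * e * K"
proof -
  note P = profilesD[OF assms]
  let ?y = "x - c * \<tau> (\<phi> x)"
  have "0 \<le> b (\<phi> ?y)" "b (\<phi> ?y) \<le> d * K"
    using b_nonneg[of "\<phi> ?y"] b_mono[of "\<phi> ?y" K] b_K P by simp_all
  moreover have "0 \<le> \<beta> * \<phi> x" "\<beta> * \<phi> x \<le> \<beta> * K"
    using \<beta>_nonneg P by (auto intro: mult_left_mono)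
  moreover have "\<beta> * K + d * K = a * e * K"
    by (simp add: \<beta>_def algebra_simps)
  ultimately show ?thesis
    unfolding reaction_def by linarith
qed

text \<open>
  A larger profile has a larger delay, hence reads off \<open>b\<close> further to the left. Profiles
  being Lipschitz, this loss is at most \<open>p * c * (a * K) \<le> \<beta>\<close> times the increase of the profile
  and is absorbed by the term \<open>\<beta> * \<phi> x\<close>.
\<close>

lemma reaction_mono:
  assumes "\<phi> \<in> profiles" "\<psi> \<in> profiles" and le: "\<And>x. \<phi> x \<le> \<psi> x"
  shows "reaction \<phi> x \<le> reaction \<psi> x"
proof -
  note P = profilesD[OF assms(1)] and Q = profilesD[OF assms(2)]
  define y z where "y = x - c * \<tau> (\<phi> x)" and "z = x - c * \<tau> (\<psi> x)"
  have "0 \<le> c * (\<tau> (\<psi> x) - \<tau> (\<phi> x))" "c * (\<tau> (\<psi> x) - \<tau> (\<phi> x)) \<le> c * (\<psi> x - \<phi> x)"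
    using \<tau>_mono[of "\<phi> x" "\<psi> x"] \<tau>_Lipschitz[of "\<phi> x" "\<psi> x"] P(2) le c_pos
    by (auto intro!: mult_left_mono)
  then have yz: "z \<le> y" "y - z \<le> c * (\<psi> x - \<phi> x)"
    by (simp_all add: y_def z_def algebra_simps)
  have "\<psi> y - \<psi> z \<le> a * K * (y - z)"
    using Q(4)[of y z] yz(1) by simp
  also have "\<dots> \<le> a * K * (c * (\<psi> x - \<phi> x))"
    using yz(2) a_pos K_pos by (intro mult_left_mono) auto
  finally have "p * (\<psi> y - \<psi> z) \<le> p * (a * K * (c * (\<psi> x - \<phi> x)))"
    using p_pos by (intro mult_left_mono) auto
  also have "\<dots> = (p * c * (a * K)) * (\<psi> x - \<phi> x)"
    by (simp only: mult_ac)
  also have "\<dots> \<le> \<beta> * (\<psi> x - \<phi> x)"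
    using \<beta>_ge le[of x] by (intro mult_right_mono) auto
  finally have "p * (\<psi> y - \<psi> z) \<le> \<beta> * \<psi> x - \<beta> * \<phi> x"
    by (simp only: right_diff_distrib)
  moreover have "b (\<phi> y) \<le> b (\<psi> y)"
    using P(2) le Q(3) by (rule b_mono)
  moreover have "b (\<psi> y) - b (\<psi> z) \<le> p * (\<psi> y - \<psi> z)"
    using Q(2) monoD[OF Q(1) yz(1)] Q(3) by (rule b_Lipschitz)
  ultimately have "\<beta> * \<phi> x + b (\<phi> y) \<le> \<beta> * \<psi> x + b (\<psi> z)"
    by linarith
  then show ?thesis
    by (simp only: reaction_def y_def z_def)
qed

section \<open>Mapping properties of the operator \<open>T\<close>\<close>

lemma T_solves:
  assumes "\<phi> \<in> profiles"
  shows "\<exists>u'. (\<forall>x. (T \<phi> has_real_derivative u' x) (at x)) \<and> (\<forall>x. \<bar>u' x\<bar> \<le> a * K) \<and>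
    (\<forall>x. (u' has_real_derivative c * u' x + a * e * T \<phi> x - reaction \<phi> x) (at x))"
proof -
  note D = green_op_solves[OF a_pos e_pos continuous_on_reaction[OF assms] reaction_bounds[OF assms]]
  have eq: "e - a = c" "a * e * K / e = a * K"
    using e_pos by (simp_all add: e_def)
  show ?thesis
    unfolding T_def by (intro exI conjI allI) (fact D(1)[unfolded eq] D(2)[unfolded eq] D(4)[unfolded eq])+
qed

lemma T_mono:
  assumes "\<phi> \<in> profiles" "\<psi> \<in> profiles" "\<And>x. \<phi> x \<le> \<psi> x"
  shows "T \<phi> x \<le> T \<psi> x"
  unfolding T_def
  by (rule green_op_mono[OF a_pos e_pos continuous_on_reaction[OF assms(1)] reaction_bounds[OF assms(1)]
        continuous_on_reaction[OF assms(2)] reaction_bounds[OF assms(2)] reaction_mono[OF assms]])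

lemma T_shift: "T (\<lambda>x. \<phi> (x + t)) x = T \<phi> (x + t)"
proof -
  have "T (\<lambda>x. \<phi> (x + t)) x = green_op a e (\<lambda>x. reaction \<phi> (x + t)) x"
    by (simp add: T_def reaction_shift[abs_def])
  then show ?thesis
    by (simp add: T_def green_op_shift[OF a_pos e_pos])
qed

lemma tendsto_T:
  fixes f :: "nat \<Rightarrow> real \<Rightarrow> real"
  assumes "\<And>n. f n \<in> profiles" "\<phi> \<in> profiles" "\<And>x. (\<lambda>n. f n x) \<longlonglongrightarrow> \<phi> x"
  shows "(\<lambda>n. T (f n) x) \<longlonglongrightarrow> T \<phi> x"
  unfolding T_def
  by (rule tendsto_green_op[OF a_pos e_pos continuous_on_reaction[OF assms(1)] reaction_bounds[OF assms(1)]
        continuous_on_reaction[OF assms(2)] tendsto_reaction[OF assms]])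

text \<open>A nondecreasing profile lies below its translates \<open>\<phi> (z + t)\<close> with
  \<open>t \<ge> 0\<close>, so monotonicity of \<open>T \<phi>\<close> follows from order
  preservation and translation invariance. The Lipschitz bound comes from the derivative bound in
  \<open>T_solves\<close>.\<close>

lemma T_profiles:
  assumes "\<phi> \<in> profiles"
  shows "T \<phi> \<in> profiles"
  unfolding profiles_def
proof (intro CollectI conjI allI)
  show "0 \<le> T \<phi> x" "T \<phi> x \<le> K" for x
    using green_op_bounds[OF a_pos e_pos continuous_on_reaction reaction_bounds, OF assms assms, of x]
      a_pos e_pos by (auto simp: T_def)
  show "mono (T \<phi>)"
  proof (rule monoI)
    fix x y :: real assume "x \<le> y"
    then have "T \<phi> x \<le> T (\<lambda>z. \<phi> (z + (y - x))) x"
      using profilesD(1)[OF assms] by (intro T_mono assms profiles_shift) (auto simp: mono_def)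
    also have "\<dots> = T \<phi> y"
      by (simp add: T_shift)
    finally show "T \<phi> x \<le> T \<phi> y" .
  qed
  obtain u' where u': "\<And>x. (T \<phi> has_real_derivative u' x) (at x)" "\<And>x. \<bar>u' x\<bar> \<le> a * K"
    using T_solves[OF assms] by blast
  show "\<bar>T \<phi> x - T \<phi> y\<bar> \<le> a * K * \<bar>x - y\<bar>" for x y
    using field_differentiable_bound[of UNIV "T \<phi>" u' "a * K" x y] u' by simp
qed

text \<open>Since \<open>b\<close> lies below the line of slope \<open>p\<close> and the delay is at
  least \<open>m\<close>, the reaction is at most \<open>(\<beta> + q) * K * exp (l * x)\<close>.
  The Green operator divides this by \<open>(a + l) * (e - l)\<close>, and \<open>char_le_0\<close>
  says exactly that the quotient \<open>(\<beta> + q) / ((a + l) * (e - l))\<close> does not exceed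
  \<open>1\<close>.\<close>

lemma T_le_exp:
  assumes "\<phi> \<in> profiles" "\<And>x. \<phi> x \<le> K * exp (l * x)"
  shows "T \<phi> x \<le> K * exp (l * x)"
proof -
  note P = profilesD[OF assms(1)]
  define q where "q = p * exp (- l * c * m)"
  have q: "0 < q" "q \<le> d + c * l - l\<^sup>2"
    using p_pos char_le_0 by (simp_all add: q_def char_fun_def)
  have R: "reaction \<phi> x \<le> (\<beta> + q) * K * exp (l * x)" for x
  proof -
    let ?y = "x - c * \<tau> (\<phi> x)"
    have "c * m \<le> c * \<tau> (\<phi> x)"
      using \<tau>_mono[of 0 "\<phi> x"] P(2) \<tau>_0 c_pos by simp
    then have "l * ?y \<le> l * (x - c * m)"
      using l_pos by (intro mult_left_mono) auto
    then have "K * exp (l * ?y) \<le> K * exp (l * (x - c * m))"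
      using K_pos by (intro mult_left_mono) auto
    then have "\<phi> ?y \<le> K * exp (l * (x - c * m))"
      using assms(2)[of ?y] by linarith
    then have "p * \<phi> ?y \<le> p * (K * exp (l * (x - c * m)))"
      using p_pos by (intro mult_left_mono) auto
    also have "\<dots> = q * K * exp (l * x)"
      by (simp add: q_def exp_add[symmetric] algebra_simps)
    finally have "b (\<phi> ?y) \<le> q * K * exp (l * x)"
      using b_le_linear[of "\<phi> ?y"] P(2,3) by fastforce
    moreover have "\<beta> * \<phi> x \<le> \<beta> * (K * exp (l * x))"
      using assms(2) \<beta>_nonneg by (intro mult_left_mono)
    ultimately show ?thesis
      by (simp add: reaction_def algebra_simps)
  qed
  have "(a + l) * (e - l) = \<beta> + (d + c * l - l\<^sup>2)"
    by (simp add: \<beta>_def e_def algebra_simps power2_eq_square)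
  then have le: "\<beta> + q \<le> (a + l) * (e - l)"
    using q by simp
  \<comment> \<open>The same comparison yields \<open>l < e\<close>, needed for the growth estimate
    of the Green operator.\<close>
  have "0 < (a + l) * (e - l)"
    using le \<beta>_nonneg q(1) by linarith
  then have el: "0 < a + l" "0 < e - l"
    using a_pos l_pos by (auto simp: zero_less_mult_iff)
  have "T \<phi> x \<le> (\<beta> + q) * K / ((a + l) * (e - l)) * exp (l * x)"
    unfolding T_def
    by (rule green_op_le_exp[OF a_pos e_pos continuous_on_reaction reaction_bounds, OF assms(1) assms(1) el R])
  also have "\<dots> \<le> K * exp (l * x)"
  proof (rule mult_right_mono)
    show "(\<beta> + q) * K / ((a + l) * (e - l)) \<le> K"
      using el le K_pos by (simp add: divide_le_eq mult.commute)
  qed simp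
  finally show ?thesis .
qed

subsection \<open>Nontrivial fixed points\<close>

text \<open>Iterating \<open>max w (T \<phi>)\<close> from \<open>w\<close> gives an increasing
  sequence: the first step cannot decrease, and \<open>T\<close> preserves order. It is bounded by
  \<open>K\<close>, and \<open>tendsto_T\<close> passes the recursion to the limit.\<close>

lemma ex_fixed_point_above:
  assumes w: "w \<in> profiles" and w_le: "\<And>x. w x \<le> K * exp (l * x)"
  shows "\<exists>\<phi>\<in>profiles. (\<forall>x. \<phi> x = max (w x) (T \<phi> x)) \<and> (\<forall>x. \<phi> x \<le> K * exp (l * x))"
proof -
  define f where "f = rec_nat w (\<lambda>_ \<phi> x. max (w x) (T \<phi> x))"
  have f_0: "f 0 = w" and f_Suc: "f (Suc n) = (\<lambda>x. max (w x) (T (f n) x))" for n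
    by (simp_all add: f_def)
  have f: "f n \<in> profiles \<and> (\<forall>x. f n x \<le> K * exp (l * x))" for n
    by (induction n) (auto simp: f_0 f_Suc w w_le T_le_exp intro: profiles_max T_profiles)
  have inc: "f n x \<le> f (Suc n) x" for n x
  proof (induction n arbitrary: x)
    case (Suc n)
    then have "T (f n) x \<le> T (f (Suc n)) x"
      using f by (intro T_mono) auto
    then show ?case
      unfolding f_Suc[of "Suc n"] f_Suc[of n] by linarith
  qed (simp add: f_0 f_Suc)
  have "\<exists>y. (\<lambda>n. f n x) \<longlonglongrightarrow> y" for x
  proof -
    have "incseq (\<lambda>n. f n x)"
      using inc by (rule incseq_SucI)
    moreover have "\<And>n. f n x \<le> K"
      using profilesD(3) f by blast
    ultimately show ?thesis
      using incseq_convergent by blast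
  qed
  then obtain \<phi> where \<phi>: "\<And>x. (\<lambda>n. f n x) \<longlonglongrightarrow> \<phi> x"
    by metis
  have prof: "\<phi> \<in> profiles"
    using f \<phi> by (blast intro: profiles_limit)
  have "\<phi> x = max (w x) (T \<phi> x)" for x
  proof (rule LIMSEQ_unique)
    show "(\<lambda>n. f (Suc n) x) \<longlonglongrightarrow> \<phi> x"
      by (rule LIMSEQ_Suc[OF \<phi>])
    show "(\<lambda>n. f (Suc n) x) \<longlonglongrightarrow> max (w x) (T \<phi> x)"
      unfolding f_Suc using f \<phi> prof by (intro tendsto_intros tendsto_T) auto
  qed
  moreover have "\<phi> x \<le> K * exp (l * x)" for x
    using f by (intro LIMSEQ_le_const2[OF \<phi>]) auto
  ultimately show ?thesis
    using prof by blast
qed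

section \<open>Limits of profiles at infinity\<close>

lemma profile_limits:
  assumes "\<phi> \<in> profiles"
  shows "\<exists>L. (\<phi> \<longlongrightarrow> L) at_top \<and> (\<forall>x. \<phi> x \<le> L) \<and> L \<le> K"
    and "\<exists>L. (\<phi> \<longlongrightarrow> L) at_bot \<and> (\<forall>x. L \<le> \<phi> x) \<and> 0 \<le> L"
proof -
  note P = profilesD[OF assms]
  have bdd: "bdd_above (range \<phi>)" "bdd_below (range \<phi>)"
    using bdd_aboveI2[of UNIV \<phi>, OF P(3)] bdd_belowI2[of UNIV _ \<phi>, OF P(2)] by simp_all
  have "(\<phi> \<longlongrightarrow> (SUP x. \<phi> x)) at_top"
  proof (rule order_tendstoI)
    fix y assume "y < (SUP x. \<phi> x)"
    then obtain x where "y < \<phi> x"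
      using less_cSUP_iff[OF _ bdd(1)] by auto
    then show "\<forall>\<^sub>F x in at_top. y < \<phi> x"
      using P(1) by (intro eventually_mono[OF eventually_ge_at_top[of x]]) (auto simp: mono_def intro: less_le_trans)
  next
    fix y assume "(SUP x. \<phi> x) < y"
    then have "\<phi> x < y" for x
      using cSUP_upper[OF _ bdd(1), of x] by auto
    then show "\<forall>\<^sub>F x in at_top. \<phi> x < y"
      by simp
  qed
  then show "\<exists>L. (\<phi> \<longlongrightarrow> L) at_top \<and> (\<forall>x. \<phi> x \<le> L) \<and> L \<le> K"
    using P bdd by (intro exI[of _ "SUP x. \<phi> x"]) (auto intro: cSUP_upper cSUP_least)
  have "(\<phi> \<longlongrightarrow> (INF x. \<phi> x)) at_bot"
  proof (rule order_tendstoI)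
    fix y assume "(INF x. \<phi> x) < y"
    then obtain x where "\<phi> x < y"
      using cINF_less_iff[OF _ bdd(2)] by auto
    then show "\<forall>\<^sub>F x in at_bot. \<phi> x < y"
      using P(1) by (intro eventually_mono[OF eventually_le_at_bot[of x]]) (auto simp: mono_def intro: le_less_trans)
  next
    fix y assume "y < (INF x. \<phi> x)"
    then have "y < \<phi> x" for x
      using cINF_lower[OF bdd(2), of x] by auto
    then show "\<forall>\<^sub>F x in at_bot. y < \<phi> x"
      by simp
  qed
  then show "\<exists>L. (\<phi> \<longlongrightarrow> L) at_bot \<and> (\<forall>x. L \<le> \<phi> x) \<and> 0 \<le> L"
    using P bdd by (intro exI[of _ "INF x. \<phi> x"]) (auto intro: cINF_lower cINF_greatest)
qed

lemma T_const:
  assumes "0 \<le> L" "L \<le> K"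
  shows "(\<lambda>_. L) \<in> profiles" "T (\<lambda>_. L) x = (\<beta> * L + b L) / (a * e)"
  using assms K_pos a_pos
  by (auto simp: profiles_def mono_def T_def reaction_def[abs_def] green_op_const[OF a_pos e_pos])

text \<open>The last hypothesis is \<open>T L \<le> L\<close> for the constant profile
  \<open>L\<close>. As \<open>a * e = \<beta> + d\<close>, it reduces to
  \<open>b L \<le> d * L\<close>, which fails strictly between \<open>0\<close> and
  \<open>K\<close>.\<close>

lemma equilibrium_cases:
  assumes "0 \<le> L" "L \<le> K" "(\<beta> * L + b L) / (a * e) \<le> L"
  shows "L = 0 \<or> L = K"
proof -
  have "\<beta> * L + b L \<le> L * (a * e)"
    using assms(3) a_pos e_pos by (simp add: divide_le_eq)
  then have "b L \<le> d * L"
    by (simp add: \<beta>_def algebra_simps)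
  then show ?thesis
    using b_below_K[of L] assms by force
qed

text \<open>Values of \<open>T \<phi>\<close> at \<open>t n\<close> are values at \<open>0\<close>
  of \<open>T\<close> on translates, and these translates converge pointwise to a constant.\<close>

lemma T_sequence_limit:
  assumes "\<phi> \<in> profiles" "0 \<le> L" "L \<le> K" "\<And>x. (\<lambda>n. \<phi> (x + t n)) \<longlonglongrightarrow> L"
  shows "(\<lambda>n. T \<phi> (t n)) \<longlonglongrightarrow> (\<beta> * L + b L) / (a * e)"
  using tendsto_T[of "\<lambda>n x. \<phi> (x + t n)" "\<lambda>_. L" 0] assms profiles_shift T_const[of L]
  by (simp add: T_shift)

text \<open>Passing to the limit in \<open>T \<phi> \<le> \<phi>\<close> along translates leaves the
  inequality for a constant. In this form it covers solutions of
  \<open>\<phi> = max w (T \<phi>)\<close> as well as fixed points.\<close>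

lemma limit_eq_0_or_K:
  assumes "\<phi> \<in> profiles" "\<And>x. T \<phi> x \<le> \<phi> x"
  shows "(\<phi> \<longlongrightarrow> L) at_top \<Longrightarrow> L = 0 \<or> L = K"
    and "(\<phi> \<longlongrightarrow> L) at_bot \<Longrightarrow> L = 0 \<or> L = K"
proof -
  have *: "L = 0 \<or> L = K" if "\<And>x. (\<lambda>n. \<phi> (x + t n)) \<longlonglongrightarrow> L" for t
  proof (rule equilibrium_cases)
    show L: "0 \<le> L" "L \<le> K"
      using profilesD[OF assms(1)]
      by (auto intro!: LIMSEQ_le_const[OF that] LIMSEQ_le_const2[OF that])
    show "(\<beta> * L + b L) / (a * e) \<le> L"
    proof (rule LIMSEQ_le)
      show "(\<lambda>n. T \<phi> (t n)) \<longlonglongrightarrow> (\<beta> * L + b L) / (a * e)"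
        by (rule T_sequence_limit[OF assms(1) L that])
      show "(\<lambda>n. \<phi> (t n)) \<longlonglongrightarrow> L"
        using that[of 0] by simp
    qed (use assms(2) in auto)
  qed
  show "L = 0 \<or> L = K" if "(\<phi> \<longlongrightarrow> L) at_top"
    by (rule *, rule filterlim_compose[OF that], rule filterlim_tendsto_add_at_top[OF tendsto_const filterlim_real_sequentially])
  show "L = 0 \<or> L = K" if "(\<phi> \<longlongrightarrow> L) at_bot"
  proof (rule *, rule filterlim_compose[OF that])
    fix x :: real
    have "LIM n sequentially. - (- x + real n) :> at_bot"
      by (rule filterlim_compose[OF filterlim_uminus_at_bot_at_top
            filterlim_tendsto_add_at_top[OF tendsto_const filterlim_real_sequentially]])
    then show "LIM n sequentially. x + - real n :> at_bot"
      by simp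
  qed
qed

text \<open>The Arzela-Ascoli argument: a diagonal subsequence converges at the rationals, and the
  common Lipschitz constant extends convergence to every real point.\<close>

lemma profiles_convergent_subsequence:
  assumes "\<And>n. f n \<in> profiles"
  obtains r \<phi> where "strict_mono (r :: nat \<Rightarrow> nat)" "\<phi> \<in> profiles" "\<And>x. (\<lambda>n. f (r n) x) \<longlonglongrightarrow> \<phi> x"
proof -
  note P = profilesD[OF assms]
  have "norm (f n x) \<le> K" for n x
    using P by simp
  then obtain r where r: "strict_mono (r :: nat \<Rightarrow> nat)"
    and conv: "\<And>x. x \<in> \<rat> \<Longrightarrow> \<exists>y. (\<lambda>n. f (r n) x) \<longlonglongrightarrow> y"
    using function_convergent_subsequence[OF countable_rat, of f K] by metis
  have aK: "0 < a * K"
    using a_pos K_pos by simp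
  have "\<exists>y. (\<lambda>n. f (r n) x) \<longlonglongrightarrow> y" for x
  proof -
    have "Cauchy (\<lambda>n. f (r n) x)"
    proof (rule metric_CauchyI)
      fix \<epsilon> :: real assume "0 < \<epsilon>"
      then have "0 < \<epsilon> / (3 * (a * K))"
        using aK by simp
      then obtain y where y: "y \<in> \<rat>" "x < y" "y < x + \<epsilon> / (3 * (a * K))"
        using Rats_dense_in_real[of x "x + \<epsilon> / (3 * (a * K))"] by auto
      have "a * K * (y - x) \<le> a * K * (\<epsilon> / (3 * (a * K)))"
        using aK y(3) by (intro mult_left_mono) auto
      also have "\<dots> = \<epsilon> / 3"
        using aK by (auto simp: field_simps)
      finally have close: "dist (f n x) (f n y) \<le> \<epsilon> / 3" for n
        using P(4)[of n x y] y(2) by (simp add: dist_real_def)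
      have "Cauchy (\<lambda>n. f (r n) y)"
        using conv[OF y(1)] convergent_Cauchy convergent_def by blast
      then obtain N where N: "\<And>i j. i \<ge> N \<Longrightarrow> j \<ge> N \<Longrightarrow> dist (f (r i) y) (f (r j) y) < \<epsilon> / 3"
        using \<open>0 < \<epsilon>\<close> metric_CauchyD[of _ "\<epsilon> / 3"] by (metis divide_pos_pos zero_less_numeral)
      have "dist (f (r i) x) (f (r j) x) < \<epsilon>" if "i \<ge> N" "j \<ge> N" for i j
        using N[OF that] close[of "r i"] close[of "r j"] unfolding dist_real_def by linarith
      then show "\<exists>N. \<forall>i\<ge>N. \<forall>j\<ge>N. dist (f (r i) x) (f (r j) x) < \<epsilon>"
        by blast
    qed
    then show ?thesis
      using Cauchy_convergent convergent_def by blast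
  qed
  then obtain \<phi> where "\<And>x. (\<lambda>n. f (r n) x) \<longlonglongrightarrow> \<phi> x"
    by metis
  then show thesis
    using that[OF r] profiles_limit[of "\<lambda>n. f (r n)"] assms by blast
qed

text \<open>The ramp keeps the limit at \<open>+\<infinity>\<close> away from \<open>0\<close>,
  hence equal to \<open>K\<close>, while the exponential bound makes the profile small on the left.
  The value \<open>K / 2\<close> is therefore attained, and translation moves it to
  \<open>0\<close>.\<close>

lemma ex_normalized_approximation:
  assumes \<epsilon>: "0 < \<epsilon>" "\<epsilon> \<le> K"
  shows "\<exists>\<psi>\<in>profiles. \<psi> 0 = K / 2 \<and> (\<forall>x. \<bar>\<psi> x - T \<psi> x\<bar> \<le> \<epsilon>)"
proof -
  \<comment> \<open>The slope \<open>\<epsilon>\<close> is at most \<open>a * K\<close>, as a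
    profile requires. The ramp vanishes for \<open>x \<le> 0\<close> and stays below
    \<open>K\<close> for \<open>x > 0\<close>, hence lies below
    \<open>K * exp (l * x)\<close>.\<close>
  define w where "w x = \<epsilon> * max 0 (min 1 x)" for x :: real
  have "a \<ge> 1"
    using p_pos c_pos K_pos d_pos by (simp add: a_def)
  then have "1 * K \<le> a * K"
    using K_pos by (intro mult_right_mono) auto
  then have \<epsilon>_le: "\<epsilon> \<le> a * K"
    using \<epsilon> by linarith
  have w_bounds: "0 \<le> w x \<and> w x \<le> \<epsilon>" for x
    using \<epsilon> by (simp add: w_def mult_left_le)
  have w: "w \<in> profiles"
    unfolding profiles_def
  proof (intro CollectI conjI allI)
    show "mono w"
      using \<epsilon> by (auto simp: mono_def w_def intro!: mult_left_mono)
    show "\<bar>w x - w y\<bar> \<le> a * K * \<bar>x - y\<bar>" for x y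
    proof -
      have "\<bar>w x - w y\<bar> = \<epsilon> * \<bar>max 0 (min 1 x) - max 0 (min 1 y)\<bar>"
        using \<epsilon> by (simp add: w_def abs_mult flip: right_diff_distrib)
      also have "\<dots> \<le> a * K * \<bar>x - y\<bar>"
        using \<epsilon> \<epsilon>_le by (intro mult_mono) auto
      finally show ?thesis .
    qed
  qed (use w_bounds \<epsilon> order_trans in blast)+
  have "w x \<le> K * exp (l * x)" for x
  proof (cases "x \<le> 0")
    case True
    then show ?thesis using K_pos by (simp add: w_def)
  next
    case False
    then have "K * 1 \<le> K * exp (l * x)"
      using K_pos l_pos by (intro mult_left_mono) auto
    then show ?thesis using w_bounds[of x] \<epsilon> by linarith
  qed
  then obtain \<phi> where \<phi>: "\<phi> \<in> profiles" "\<And>x. \<phi> x = max (w x) (T \<phi> x)"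
    "\<And>x. \<phi> x \<le> K * exp (l * x)"
    using ex_fixed_point_above[OF w] by blast
  obtain L where L: "(\<phi> \<longlongrightarrow> L) at_top" "\<And>x. \<phi> x \<le> L"
    using profile_limits(1)[OF \<phi>(1)] by blast
  have T_le: "T \<phi> x \<le> \<phi> x" for x
    using \<phi>(2)[of x] by linarith
  have "0 < \<phi> 1"
    using \<phi>(2)[of 1] \<epsilon> by (simp add: w_def less_max_iff_disj)
  then have "L = K"
    using limit_eq_0_or_K(1)[OF \<phi>(1) T_le L(1)] L(2)[of 1] by linarith
  then have "\<forall>\<^sub>F x in at_top. K / 2 < \<phi> x"
    using L(1) K_pos by (intro order_tendstoD) auto
  then obtain x1 where x1: "K / 2 < \<phi> x1"
    using eventually_happens by fastforce
  \<comment> \<open>Here \<open>K * exp (l * x)\<close> takes the value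
    \<open>K / 2\<close>.\<close>
  define x0 where "x0 = ln (1 / 2) / l"
  have "\<phi> x0 \<le> K / 2"
    using \<phi>(3)[of x0] l_pos by (simp add: x0_def)
  moreover have "x0 \<le> x1"
    using calculation x1 monoD[OF profilesD(1)[OF \<phi>(1)], of x1 x0] by (cases "x0 \<le> x1") auto
  ultimately obtain z where z: "\<phi> z = K / 2"
    using IVT'[of \<phi> x0 "K / 2" x1] x1 continuous_on_profile[OF \<phi>(1)] by force
  \<comment> \<open>Where the ramp wins in the maximum,
    \<open>\<phi> - T \<phi> = w - T \<phi> \<le> w \<le> \<epsilon>\<close>; elsewhere the
    difference is \<open>0\<close>. This uniform bound, unlike the equation with \<open>w\<close>,
    is invariant under translation.\<close>
  have "0 \<le> T \<phi> x" for x
    using profilesD(2)[OF T_profiles[OF \<phi>(1)]] .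
  then have "\<bar>\<phi> x - T \<phi> x\<bar> \<le> \<epsilon>" for x
    using \<phi>(2)[of x] w_bounds[of x] by (smt (verit))
  then show ?thesis
    using z \<phi>(1) by (intro bexI[of _ "\<lambda>x. \<phi> (x + z)"] profiles_shift) (auto simp: T_shift)
qed

text \<open>Along a convergent subsequence the defect tends to \<open>0\<close> while the
  normalisation at \<open>0\<close> persists, which excludes the constant fixed points
  \<open>0\<close> and \<open>K\<close>.\<close>

lemma ex_nontrivial_fixed_point: "\<exists>\<phi>\<in>profiles. \<phi> 0 = K / 2 \<and> T \<phi> = \<phi>"
proof -
  define \<epsilon> where "\<epsilon> n = K / real (Suc n)" for n
  have "0 < \<epsilon> n \<and> \<epsilon> n \<le> K" for n
    using K_pos by (auto simp: \<epsilon>_def field_simps)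
  then have "\<forall>n. \<exists>\<psi>. \<psi> \<in> profiles \<and> \<psi> 0 = K / 2 \<and> (\<forall>x. \<bar>\<psi> x - T \<psi> x\<bar> \<le> \<epsilon> n)"
    using ex_normalized_approximation by blast
  then obtain f where f: "\<And>n. f n \<in> profiles" "\<And>n. f n 0 = K / 2"
    "\<And>n x. \<bar>f n x - T (f n) x\<bar> \<le> \<epsilon> n"
    by metis
  obtain r \<phi> where r: "strict_mono (r :: nat \<Rightarrow> nat)" and \<phi>: "\<phi> \<in> profiles"
    and lim: "\<And>x. (\<lambda>n. f (r n) x) \<longlonglongrightarrow> \<phi> x"
    using profiles_convergent_subsequence[of f] f(1) by metis
  have "\<epsilon> \<longlonglongrightarrow> 0"
    unfolding \<epsilon>_def by (intro lim_const_over_n[THEN LIMSEQ_Suc])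
  then have "(\<lambda>n. \<epsilon> (r n)) \<longlonglongrightarrow> 0"
    using LIMSEQ_subseq_LIMSEQ[OF _ r] by (auto simp: o_def)
  then have "(\<lambda>n. f (r n) x - T (f (r n)) x) \<longlonglongrightarrow> 0" for x
    by (rule Lim_null_comparison[rotated]) (simp add: f(3))
  moreover have "(\<lambda>n. f (r n) x - T (f (r n)) x) \<longlonglongrightarrow> \<phi> x - T \<phi> x" for x
    using f(1) \<phi> by (intro tendsto_diff tendsto_T lim)
  ultimately have "\<phi> x - T \<phi> x = 0" for x
    using LIMSEQ_unique by blast
  moreover have "\<phi> 0 = K / 2"
    using LIMSEQ_unique[OF lim[of 0], of "K / 2"] f(2) by simp
  ultimately show ?thesis
    using \<phi> by (intro bexI[of _ \<phi>]) (auto simp: fun_eq_iff)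
qed

theorem ex_wavefront:
  "\<exists>\<phi> \<phi>' \<phi>'' :: real \<Rightarrow> real.
    mono \<phi> \<and>
    (\<forall>\<xi>. (\<phi> has_real_derivative \<phi>' \<xi>) (at \<xi>)) \<and>
    (\<forall>\<xi>. (\<phi>' has_real_derivative \<phi>'' \<xi>) (at \<xi>)) \<and>
    continuous_on UNIV \<phi>'' \<and>
    (\<forall>\<xi>. \<phi>'' \<xi> - c * \<phi>' \<xi> - d * \<phi> \<xi> + b (\<phi> (\<xi> - c * \<tau> (\<phi> \<xi>))) = 0) \<and>
    (\<phi> \<longlongrightarrow> 0) at_bot \<and>
    (\<phi> \<longlongrightarrow> K) at_top"
proof -
  obtain \<phi> where \<phi>: "\<phi> \<in> profiles" "\<phi> 0 = K / 2" "T \<phi> = \<phi>"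
    using ex_nontrivial_fixed_point by blast
  obtain \<phi>' where D: "\<And>x. (\<phi> has_real_derivative \<phi>' x) (at x)"
    "\<And>x. (\<phi>' has_real_derivative c * \<phi>' x + a * e * \<phi> x - reaction \<phi> x) (at x)"
    using T_solves[OF \<phi>(1)] unfolding \<phi>(3) by blast
  let ?\<phi>'' = "\<lambda>x. c * \<phi>' x + a * e * \<phi> x - reaction \<phi> x"
  have cont: "continuous_on UNIV ?\<phi>''"
    using has_real_derivative_imp_borel(1)[OF D(1)] has_real_derivative_imp_borel(1)[OF D(2)]
    by (intro continuous_intros continuous_on_reaction \<phi>(1))
  \<comment> \<open>The terms with \<open>\<beta>\<close> cancel, since
    \<open>a * e - \<beta> = d\<close>.\<close>
  have ode: "?\<phi>'' x - c * \<phi>' x - d * \<phi> x + b (\<phi> (x - c * \<tau> (\<phi> x))) = 0" for x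
    by (simp add: reaction_def \<beta>_def algebra_simps)
  obtain L where L: "(\<phi> \<longlongrightarrow> L) at_top" "\<And>x. \<phi> x \<le> L"
    using profile_limits(1)[OF \<phi>(1)] by blast
  \<comment> \<open>Both limits lie in \<open>{0, K}\<close>; monotonicity puts \<open>K / 2\<close>
    between them, so the upper one is \<open>K\<close> and the lower one, treated next, is
    \<open>0\<close>.\<close>
  have "L = K"
    using limit_eq_0_or_K(1)[OF \<phi>(1) _ L(1)] L(2)[of 0] \<phi>(2,3) K_pos by auto
  obtain L' where L': "(\<phi> \<longlongrightarrow> L') at_bot" "\<And>x. L' \<le> \<phi> x"
    using profile_limits(2)[OF \<phi>(1)] by blast
  have "L' = 0"
    using limit_eq_0_or_K(2)[OF \<phi>(1) _ L'(1)] L'(2)[of 0] \<phi>(2,3) K_pos by auto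
  have "mono \<phi>" "(\<phi> \<longlongrightarrow> 0) at_bot" "(\<phi> \<longlongrightarrow> K) at_top"
    using profilesD(1)[OF \<phi>(1)] L(1) L'(1) \<open>L = K\<close> \<open>L' = 0\<close> by simp_all
  then show ?thesis
    using D cont ode by (intro exI[of _ \<phi>] exI[of _ \<phi>'] exI[of _ ?\<phi>''] conjI allI)
qed

end

subsection \<open>The wave at the critical speed\<close>

text \<open>The mean value theorem, with derivatives relative to the interval because
  \<open>b\<close> and \<open>\<tau>\<close> are differentiable only one-sidedly at the ends of
  their domains.\<close>

lemma increment_bounds:
  fixes f :: "real \<Rightarrow> real"
  assumes "u \<le> v" "\<And>x. x \<in> {u..v} \<Longrightarrow> (f has_real_derivative f' x) (at x within {u..v})"
    "\<And>x. x \<in> {u..v} \<Longrightarrow> 0 \<le> f' x \<and> f' x \<le> B"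
  shows "f u \<le> f v" "f v - f u \<le> B * (v - u)"
proof -
  have "f u \<le> f v \<and> f v - f u \<le> B * (v - u)"
  proof (cases "u = v")
    case False
    then have "u < v" using assms(1) by simp
    then obtain x where x: "x \<in> {u<..<v}" "f v - f u = f' x * (v - u)"
      using mvt_simple[of u v f "\<lambda>x. (*) (f' x)"] assms(2)
      by (auto simp: has_field_derivative_def)
    then have "0 \<le> f' x * (v - u)" "f' x * (v - u) \<le> B * (v - u)"
      using assms(3)[of x] assms(1) by (auto intro!: mult_right_mono)
    with x(2) show ?thesis by linarith
  qed simp
  then show "f u \<le> f v" "f v - f u \<le> B * (v - u)"
    by auto
qed

text \<open>The definition of the critical speed provides roots only for larger speeds. Roots for
  speeds decreasing to it stay bounded, and a limit point is a root by continuity; it is not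
  \<open>0\<close>, where the characteristic function equals \<open>p - d > 0\<close>.\<close>

lemma ex_root_critical_speed:
  assumes "0 < d" "d < p" "0 \<le> m"
  shows "\<exists>l>0. char_fun d p m l (critical_speed d p m) = 0"
proof -
  define cs where "cs = critical_speed d p m"
  have crit: "is_critical_speed d p m cs"
    unfolding cs_def using assms by (rule is_critical_speed_critical_speed)
  have cs: "0 < cs"
    using crit by (simp add: is_critical_speed_def)
  define s where "s n = cs + 1 / real (Suc n)" for n
  have s: "cs < s n" "s n \<le> cs + 1" for n
    by (simp_all add: s_def)
  have "\<exists>l>0. char_fun d p m l (s n) = 0" for n
  proof -
    obtain l1 l2 where "{l. l > 0 \<and> char_fun d p m l (s n) = 0} = {l1, l2}"
      using crit s(1)[of n] unfolding is_critical_speed_def by meson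
    then show ?thesis by blast
  qed
  then obtain l where l: "\<And>n. 0 < l n" "\<And>n. char_fun d p m (l n) (s n) = 0"
    by metis
  \<comment> \<open>Beyond this bound \<open>l n - s n \<ge> 1\<close>, so the quadratic part is at
    least \<open>l n - d > 0\<close> and no root is possible.\<close>
  have "l n \<le> cs + d + 2" for n
  proof (rule ccontr)
    assume "\<not> l n \<le> cs + d + 2"
    then have "l n * 1 \<le> l n * (l n - s n)" "d < l n"
      using s[of n] l(1)[of n] cs assms(1) by (auto intro!: mult_left_mono simp: less_imp_le)
    moreover have "0 < p * exp (- l n * s n * m)"
      using assms by simp
    ultimately show False
      using l(2)[of n] by (simp add: char_fun_def power2_eq_square algebra_simps)
  qed
  then have "\<forall>n. l n \<in> {0..cs + d + 2}"
    using l(1) by (auto simp: less_imp_le)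
  then obtain l0 r where r: "strict_mono (r :: nat \<Rightarrow> nat)" and lim: "(l \<circ> r) \<longlonglongrightarrow> l0" and l0: "0 \<le> l0"
    using compact_Icc[of 0 "cs + d + 2"] unfolding compact_def by (metis atLeastAtMost_iff)
  have "(\<lambda>n. cs + 1 / real (Suc n)) \<longlonglongrightarrow> cs + 0"
    by (intro tendsto_intros lim_const_over_n[THEN LIMSEQ_Suc])
  then have "s \<longlonglongrightarrow> cs"
    by (simp add: s_def[abs_def])
  then have "(s \<circ> r) \<longlonglongrightarrow> cs"
    using r by (rule LIMSEQ_subseq_LIMSEQ)
  with lim have "(\<lambda>n. char_fun d p m ((l \<circ> r) n) ((s \<circ> r) n)) \<longlonglongrightarrow> char_fun d p m l0 cs"
    unfolding char_fun_def by (intro tendsto_intros)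
  then have "(\<lambda>n. 0) \<longlonglongrightarrow> char_fun d p m l0 cs"
    by (simp add: l(2))
  then have "char_fun d p m l0 cs = 0"
    by (simp add: LIMSEQ_const_iff)
  moreover have "l0 \<noteq> 0"
    using calculation assms by (auto simp: char_fun_def)
  ultimately show ?thesis
    using l0 unfolding cs_def by (intro exI[of _ l0]) auto
qed

theorem theorem2p15:
  fixes d K m M c :: real and b b' \<tau> \<tau>' :: "real \<Rightarrow> real"
  assumes d_pos: "d > 0"
    and K_pos: "K > 0"
    and b_nonneg: "\<And>u. u \<ge> 0 \<Longrightarrow> b u \<ge> 0"
    and b_0: "b 0 = 0"
    and b_K: "b K = d * K"
    and b_below_K: "\<And>u. u \<in> {0<..<K} \<Longrightarrow> b u > d * u"
    and b_above_K: "\<And>u. u > K \<Longrightarrow> 0 < b u \<and> b u < d * u"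
    and tau_nonneg: "\<And>u. u \<ge> 0 \<Longrightarrow> \<tau> u \<ge> 0"
    and tau_deriv: "\<And>u. u \<ge> 0 \<Longrightarrow> (\<tau> has_real_derivative \<tau>' u) (at u within {0..})"
    and tau_C1: "continuous_on {0..} \<tau>'"
    and tau'_bounds: "\<And>u. u \<ge> 0 \<Longrightarrow> 0 \<le> \<tau>' u \<and> \<tau>' u < 1"
    and tau_0: "m = \<tau> 0"
    and tau_lim: "(\<tau> \<longlongrightarrow> M) at_top"
    and m_M: "0 \<le> m" "m \<le> M"
    and b_deriv: "\<And>u. u \<in> {0..K} \<Longrightarrow> (b has_real_derivative b' u) (at u within {0..K})"
    and b_C1: "continuous_on {0..K} b'"
    and b'_0: "b' 0 > d"
    and b_sublinear: "\<And>u. u \<in> {0<..K} \<Longrightarrow> b u < b' 0 * u"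
    and b'_bounds: "\<And>u. u \<in> {0..K} \<Longrightarrow> 0 \<le> b' u \<and> b' u \<le> b' 0"
    and b_quadratic: "\<exists>L>0. \<forall>u\<in>{0<..K}. 0 \<le> b' 0 * u - b u \<and> b' 0 * u - b u < L * u\<^sup>2"
    and c_critical: "c = critical_speed d (b' 0) m"
  shows "\<exists>\<phi> \<phi>' \<phi>'' :: real \<Rightarrow> real.
    mono \<phi> \<and>
    (\<forall>\<xi>. (\<phi> has_real_derivative \<phi>' \<xi>) (at \<xi>)) \<and>
    (\<forall>\<xi>. (\<phi>' has_real_derivative \<phi>'' \<xi>) (at \<xi>)) \<and>
    continuous_on UNIV \<phi>'' \<and>
    (\<forall>\<xi>. \<phi>'' \<xi> - c * \<phi>' \<xi> - d * \<phi> \<xi> + b (\<phi> (\<xi> - c * \<tau> (\<phi> \<xi>))) = 0) \<and>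
    (\<phi> \<longlongrightarrow> 0) at_bot \<and>
    (\<phi> \<longlongrightarrow> K) at_top"
proof -
  have p: "d < b' 0" "0 < b' 0"
    using b'_0 d_pos by auto
  obtain l where l: "0 < l" "char_fun d (b' 0) m l c = 0"
    using ex_root_critical_speed[OF d_pos p(1) m_M(1)] unfolding c_critical by blast
  have c: "0 < c"
    using is_critical_speed_critical_speed[OF d_pos p(1) m_M(1)]
    unfolding c_critical by (simp add: is_critical_speed_def)
  have b_incr: "b u \<le> b v \<and> b v - b u \<le> b' 0 * (v - u)" if "0 \<le> u" "u \<le> v" "v \<le> K" for u v
  proof -
    have "(b has_real_derivative b' x) (at x within {u..v})" if "x \<in> {u..v}" for x
      using b_deriv[of x] that \<open>0 \<le> u\<close> \<open>v \<le> K\<close>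
      by (auto intro: has_field_derivative_subset)
    then show ?thesis
      using increment_bounds[of u v b b' "b' 0"] b'_bounds that by auto
  qed
  have \<tau>_incr: "\<tau> u \<le> \<tau> v \<and> \<tau> v - \<tau> u \<le> v - u" if "0 \<le> u" "u \<le> v" for u v
  proof -
    have "(\<tau> has_real_derivative \<tau>' x) (at x within {u..v})" if "x \<in> {u..v}" for x
      using tau_deriv[of x] that \<open>0 \<le> u\<close> by (auto intro: has_field_derivative_subset)
    moreover have "0 \<le> \<tau>' x \<and> \<tau>' x \<le> 1" if "x \<in> {u..v}" for x
      using tau'_bounds[of x] that \<open>0 \<le> u\<close> by auto
    ultimately show ?thesis
      using increment_bounds[of u v \<tau> \<tau>' 1] that by auto
  qed
  \<comment> \<open>The bound \<open>b' u \<le> b' 0\<close> makes \<open>b' 0\<close> a Lipschitz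
    constant of \<open>b\<close>, and the root \<open>l\<close> gives \<open>char_le_0\<close> with
    equality.\<close>
  interpret wave d "b' 0" K c m l b \<tau>
    using d_pos K_pos c p l b_incr \<tau>_incr b_0 b_K b_below_K tau_0 by unfold_locales auto
  show ?thesis
    by (rule ex_wavefront)
qed

end
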